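(* Every odd-$C_5^{+}$-free graph $H$ satisfies $\chi'(H)=\max(\Delta(H),\lceil\Gamma'(H)\rceil)$.
   Context: Graphs are finite, undirected and loopless, and may have multiple edges. A subdivision of a graph $K$ is a graph obtained by replacing every edge $e$ of $K$ by a path $P_e$ of non-zero length joining the ends of $e$, the paths $P_e$ being pairwise disjoint except possibly at their ends; it is a totally odd subdivision if every $P_e$ has odd length (number of edges). $C_5^{+}$ is the graph with vertex set $\{1,2,3,4,5\}$ and edge set $\{12,23,34,45,15,25\}$. A graph is odd-$C_5^{+}$-free if no subgraph of it (not necessarily induced) is isomorphic to a totally odd subdivision of $C_5^{+}$. The chromatic index $\chi'(H)$ is the least $k$ such that $E(H)$ can be covered by $k$ matchings (sets of pairwise non-incident edges). The degree $d_H(v)$ of a vertex is the number of edges incident with it (counting parallel edges) and $\Delta(H)$ is the maximum degree. An odd ring of $H$ is an induced subgraph of $H$ (with all parallel edges kept) whose underlying simple graph is an odd circuit (possibly of length $3$). Finally $$\Gamma'(H)=\max\Big\{\frac{2}{|V(R)|-1}|E(R)|:\ R\text{ is an odd ring of }H\Big\},$$ with $\Gamma'(H)=0$ if $H$ has no odd ring. *)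

theory Defs
  imports Complex_Main
begin

record ('a, 'b) pre_multigraph =
  verts :: "'a set"
  edges :: "'b set"
  ends :: "'b \<Rightarrow> 'a set"

text \<open>Finite, undirected and loopless; parallel edges are distinct edges with the same ends.\<close>

locale multigraph =
  fixes G :: "('a, 'b) pre_multigraph"
  assumes finite_verts: "finite (verts G)"
    and finite_edges: "finite (edges G)"
    and ends_in_verts: "\<And>e. e \<in> edges G \<Longrightarrow> ends G e \<subseteq> verts G"
    and card_ends: "\<And>e. e \<in> edges G \<Longrightarrow> card (ends G e) = 2"

definition subgraph :: "('a, 'b) pre_multigraph \<Rightarrow> ('a, 'b) pre_multigraph \<Rightarrow> bool" where
  "subgraph S G \<longleftrightarrow>
     multigraph S \<and> verts S \<subseteq> verts G \<and> edges S \<subseteq> edges G \<and>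
     (\<forall>e\<in>edges S. ends S e = ends G e)"

definition induced_subgraph :: "('a, 'b) pre_multigraph \<Rightarrow> 'a set \<Rightarrow> ('a, 'b) pre_multigraph" where
  "induced_subgraph G X =
     \<lparr>verts = X, edges = {e \<in> edges G. ends G e \<subseteq> X}, ends = ends G\<rparr>"

definition isomorphic :: "('a, 'b) pre_multigraph \<Rightarrow> ('c, 'd) pre_multigraph \<Rightarrow> bool" where
  "isomorphic G H \<longleftrightarrow>
     (\<exists>f g. bij_betw f (verts G) (verts H) \<and> bij_betw g (edges G) (edges H) \<and>
            (\<forall>e\<in>edges G. ends H (g e) = f ` ends G e))"

text \<open>A path is given by its vertex sequence and its edge sequence; its length is the length
  of the latter.\<close>

definition is_path :: "('a, 'b) pre_multigraph \<Rightarrow> 'a list \<times> 'b list \<Rightarrow> bool" where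
  "is_path G = (\<lambda>(vs, es).
     length vs = length es + 1 \<and> distinct vs \<and> set vs \<subseteq> verts G \<and> set es \<subseteq> edges G \<and>
     (\<forall>i<length es. ends G (es ! i) = {vs ! i, vs ! Suc i}))"

text \<open>\<open>T\<close> arises from \<open>K\<close> by replacing each edge \<open>e\<close> by the path \<open>P e\<close>. The vertices of \<open>K\<close>
  are kept, so the interior vertices of the paths are new.\<close>

definition subdivision_by ::
  "('a, 'b) pre_multigraph \<Rightarrow> ('b \<Rightarrow> 'a list \<times> 'c list) \<Rightarrow> ('a, 'c) pre_multigraph \<Rightarrow> bool" where
  "subdivision_by K P T \<longleftrightarrow>
     multigraph T \<and>
     (\<forall>e\<in>edges K. is_path T (P e) \<and> snd (P e) \<noteq> [] \<and>
        {hd (fst (P e)), last (fst (P e))} = ends K e \<and>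
        set (fst (P e)) \<inter> verts K = ends K e) \<and>
     (\<forall>e\<in>edges K. \<forall>f\<in>edges K. e \<noteq> f \<longrightarrow>
        set (fst (P e)) \<inter> set (fst (P f)) \<subseteq> ends K e \<inter> ends K f \<and>
        set (snd (P e)) \<inter> set (snd (P f)) = {}) \<and>
     verts T = verts K \<union> (\<Union>e\<in>edges K. set (fst (P e))) \<and>
     edges T = (\<Union>e\<in>edges K. set (snd (P e)))"

definition totally_odd_subdivision ::
  "('a, 'b) pre_multigraph \<Rightarrow> ('a, 'c) pre_multigraph \<Rightarrow> bool" where
  "totally_odd_subdivision K T \<longleftrightarrow>
     (\<exists>P. subdivision_by K P T \<and> (\<forall>e\<in>edges K. odd (length (snd (P e)))))"

definition C5plus :: "(nat, nat set) pre_multigraph" where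
  "C5plus = \<lparr>verts = {1, 2, 3, 4, 5},
             edges = {{1, 2}, {2, 3}, {3, 4}, {4, 5}, {1, 5}, {2, 5}},
             ends = (\<lambda>e. e)\<rparr>"

text \<open>Subdivisions are finite, so up to isomorphism it suffices to consider those whose
  vertices and edges are natural numbers.\<close>

definition odd_C5plus_free :: "('a, 'b) pre_multigraph \<Rightarrow> bool" where
  "odd_C5plus_free G \<longleftrightarrow>
     \<not> (\<exists>S (T :: (nat, nat) pre_multigraph).
          subgraph S G \<and> totally_odd_subdivision C5plus T \<and> isomorphic S T)"

definition matching :: "('a, 'b) pre_multigraph \<Rightarrow> 'b set \<Rightarrow> bool" where
  "matching G M \<longleftrightarrow>
     M \<subseteq> edges G \<and> (\<forall>e\<in>M. \<forall>f\<in>M. e \<noteq> f \<longrightarrow> ends G e \<inter> ends G f = {})"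

definition chromatic_index :: "('a, 'b) pre_multigraph \<Rightarrow> nat" where
  "chromatic_index G =
     (LEAST k. \<exists>M :: nat \<Rightarrow> 'b set. (\<forall>i<k. matching G (M i)) \<and> edges G = (\<Union>i<k. M i))"

definition vertex_degree :: "('a, 'b) pre_multigraph \<Rightarrow> 'a \<Rightarrow> nat" where
  "vertex_degree G v = card {e \<in> edges G. v \<in> ends G e}"

text \<open>The inserted \<open>0\<close> only matters for the graph without vertices.\<close>

definition max_degree :: "('a, 'b) pre_multigraph \<Rightarrow> nat" where
  "max_degree G = Max (insert 0 (vertex_degree G ` verts G))"

definition underlying_simple :: "('a, 'b) pre_multigraph \<Rightarrow> ('a, 'a set) pre_multigraph" where
  "underlying_simple G = \<lparr>verts = verts G, edges = ends G ` edges G, ends = (\<lambda>e. e)\<rparr>"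

definition odd_circuit :: "('a, 'a set) pre_multigraph \<Rightarrow> bool" where
  "odd_circuit C \<longleftrightarrow>
     (\<exists>vs. distinct vs \<and> length vs \<ge> 3 \<and> odd (length vs) \<and> verts C = set vs \<and>
           edges C = {{vs ! i, vs ! (Suc i mod length vs)} | i. i < length vs} \<and>
           (\<forall>e\<in>edges C. ends C e = e))"

definition odd_ring :: "('a, 'b) pre_multigraph \<Rightarrow> ('a, 'b) pre_multigraph \<Rightarrow> bool" where
  "odd_ring G R \<longleftrightarrow>
     (\<exists>X\<subseteq>verts G. R = induced_subgraph G X) \<and> odd_circuit (underlying_simple R)"

definition Gamma_prime :: "('a, 'b) pre_multigraph \<Rightarrow> real" where
  "Gamma_prime G =
     (if \<exists>R. odd_ring G R
      then Max {2 / (real (card (verts R)) - 1) * real (card (edges R)) | R. odd_ring G R}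
      else 0)"

end

theory Submission
  imports Defs
begin

text \<open>The lower bound is clear. For the upper bound let \<open>k = max(\<Delta>, \<lceil>\<Gamma>'\<rceil>)\<close>, and colour the edges with
  \<open>k\<close> colours one by one. Being odd-\<open>C\<^sub>5\<^sup>+\<close>-free means that odd cycles have no chord and no odd ear.

  Let \<open>e = xy\<close> be the next edge, \<open>x\<close> missing \<open>\<alpha>\<close> and \<open>y\<close> missing \<open>\<beta>\<close>. If \<open>e\<close> cannot be coloured, then
  the \<open>\<alpha>\<close>-\<open>\<beta>\<close> chain from \<open>x\<close> ends in \<open>y\<close> and forms an odd cycle \<open>C\<close> of length \<open>2s + 1\<close> with \<open>e\<close>. As \<open>C\<close>
  spans at most \<open>ks\<close> edges, including \<open>e\<close>, some colour \<open>\<gamma>\<close> occurs fewer than \<open>s\<close> times on \<open>C\<close>, so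
  the set \<open>U\<close> of vertices of \<open>C\<close> without a \<open>\<gamma>\<close>-edge inside \<open>C\<close> has at least three elements. An \<open>\<alpha>\<close>-\<open>\<gamma>\<close>
  chain that leaves \<open>C\<close> does so through a \<open>\<gamma>\<close>-edge, and returning through another one would give an
  odd ear; so the chain of \<open>x\<close> meets \<open>U\<close> at most once, and some vertex of \<open>U\<close> lies in another
  \<open>\<alpha>\<close>-\<open>\<gamma>\<close> component \<open>K\<close>. Swap \<open>\<alpha>\<close> and \<open>\<gamma>\<close> on \<open>K\<close>. Now the \<open>\<alpha>\<close>-\<open>\<beta>\<close> chain from \<open>x\<close> follows \<open>C\<close> to its first
  vertex in \<open>K\<close>, where it stops or leaves \<open>C\<close> through an \<open>\<alpha>\<close>-edge; it again cannot return, so it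
  misses \<open>y\<close> and \<open>e\<close> can be coloured after all.\<close>

section \<open>Theta graphs and ears of odd cycles\<close>

definition adjacent :: "('a, 'b) pre_multigraph \<Rightarrow> 'a \<Rightarrow> 'a \<Rightarrow> bool" where
  "adjacent G u v \<longleftrightarrow> (\<exists>e\<in>edges G. ends G e = {u, v})"

text \<open>Vertex lists suffice, since one edge of \<open>H\<close> can be chosen for each pair of
  consecutive vertices. An even number of vertices gives an odd number of edges. The map
  \<open>h\<close> places the branch vertices.\<close>

lemma totally_odd_subdivision_in_graph:
  fixes K :: "(nat, 'c) pre_multigraph" and H :: "('a, 'b) pre_multigraph"
  assumes H: "multigraph H" and K: "multigraph K"
    and simple: "\<And>e f. e \<in> edges K \<Longrightarrow> f \<in> edges K \<Longrightarrow> e \<noteq> f \<Longrightarrow> card (ends K e \<inter> ends K f) \<le> 1"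
    and h: "inj_on h (verts K)" "h ` verts K \<subseteq> verts H"
    and L: "\<And>e. e \<in> edges K \<Longrightarrow> distinct (L e) \<and> even (length (L e)) \<and> L e \<noteq> [] \<and>
        successively (adjacent H) (L e) \<and> {hd (L e), last (L e)} = h ` ends K e \<and>
        set (L e) \<inter> h ` verts K = h ` ends K e"
    and disj': "\<And>e f. e \<in> edges K \<Longrightarrow> f \<in> edges K \<Longrightarrow> e \<noteq> f \<Longrightarrow>
        set (L e) \<inter> set (L f) \<subseteq> h ` ends K e \<inter> h ` ends K f"
  shows "\<exists>S (T :: (nat, nat) pre_multigraph).
      subgraph S H \<and> totally_odd_subdivision K T \<and> isomorphic S T"
proof -
  interpret H: multigraph H by (rule H)
  interpret K: multigraph K by (rule K)
  have disj: "set (L e) \<inter> set (L f) \<subseteq> h ` (ends K e \<inter> ends K f)"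
    if "e \<in> edges K" "f \<in> edges K" "e \<noteq> f" for e f
    using disj'[OF that] inj_on_image_Int[OF h(1) K.ends_in_verts[OF that(1)] K.ends_in_verts[OF that(2)]]
    by simp
  define V where "V = h ` verts K \<union> (\<Union>e\<in>edges K. set (L e))"
  have finV: "finite V"
    unfolding V_def using K.finite_verts K.finite_edges by auto
  obtain \<phi> :: "'a \<Rightarrow> nat" where \<phi>: "inj_on \<phi> V"
    using finite_imp_inj_to_nat_seg[OF finV] by auto
  \<comment> \<open>A subdivision keeps the vertices of \<open>K\<close>, so \<open>h i\<close> must
    be renamed to \<open>i\<close> itself; all other vertices get numbers above
    \<open>Max (verts K)\<close>.\<close>
  define f where "f v = (if v \<in> h ` verts K then inv_into (verts K) h v
      else \<phi> v + Suc (Max (verts K)))" for v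
  have fh: "f (h i) = i" if "i \<in> verts K" for i
    using that h(1) unfolding f_def by simp
  have big: "f v \<notin> verts K" if "v \<notin> h ` verts K" for v
  proof
    assume "f v \<in> verts K"
    then have "f v \<le> Max (verts K)" using K.finite_verts by simp
    then show False using that unfolding f_def by simp
  qed
  have injf: "inj_on f V"
  proof (rule inj_onI)
    fix u v assume uv: "u \<in> V" "v \<in> V" "f u = f v"
    show "u = v"
    proof (cases "u \<in> h ` verts K")
      case True
      then have "f u \<in> verts K" using fh by auto
      then have "v \<in> h ` verts K" using uv(3) big[of v] by auto
      then show ?thesis using True uv fh by auto
    next
      case False
      then have "f v \<notin> verts K" using uv(3) big[of u] by simp
      then have "v \<notin> h ` verts K" using fh by auto
      then have "\<phi> u = \<phi> v" using False uv(3) by (simp add: f_def)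
      then show ?thesis using uv \<phi> by (auto dest: inj_onD)
    qed
  qed
  \<comment> \<open>One fixed representative among the parallel edges with ends
    \<open>X\<close>.\<close>
  define ed where "ed X = (SOME e. e \<in> edges H \<and> ends H e = X)" for X
  have ed: "ed {u, v} \<in> edges H \<and> ends H (ed {u, v}) = {u, v}" if "adjacent H u v" for u v
    unfolding ed_def by (rule someI_ex) (use that in \<open>auto simp: adjacent_def\<close>)
  define le where "le e = map (\<lambda>i. ed {L e ! i, L e ! Suc i}) [0..<length (L e) - 1]" for e
  have adjL: "adjacent H (L e ! i) (L e ! Suc i)" if "e \<in> edges K" "i < length (L e) - 1" for e i
    using L[OF that(1)] that(2) by (auto simp: successively_conv_nth)
  have len: "2 \<le> length (L e)" if "e \<in> edges K" for e
    using L[OF that] by (cases "L e"; cases "tl (L e)"; auto)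
  have LV: "set (L e) \<subseteq> V" if "e \<in> edges K" for e
    using that unfolding V_def by auto
  have VH: "V \<subseteq> verts H"
  proof -
    have "v \<in> verts H" if e: "e \<in> edges K" and v: "v \<in> set (L e)" for e v
    proof -
      obtain i where i: "i < length (L e)" "v = L e ! i" using v by (metis in_set_conv_nth)
      show ?thesis
      proof (cases "i < length (L e) - 1")
        case True
        then show ?thesis using ed[OF adjL[OF e True]] H.ends_in_verts i by fastforce
      next
        case False
        then have "i - 1 < length (L e) - 1" "Suc (i - 1) = i" using i len[OF e] by auto
        then show ?thesis using ed[OF adjL[OF e, of "i - 1"]] H.ends_in_verts i by fastforce
      qed
    qed
    then show ?thesis using h(2) unfolding V_def by auto
  qed
  define E where "E = (\<Union>e\<in>edges K. set (le e))"
  have le: "x \<in> edges H \<and> ends H x \<subseteq> set (L e)" if e: "e \<in> edges K" and x: "x \<in> set (le e)" for e x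
  proof -
    obtain i where "i < length (L e) - 1" "x = ed {L e ! i, L e ! Suc i}"
      using x unfolding le_def by auto
    then show ?thesis using ed[OF adjL[OF e]] by auto
  qed
  have EH: "E \<subseteq> edges H" and EV: "\<And>x. x \<in> E \<Longrightarrow> ends H x \<subseteq> V"
    using le LV unfolding E_def by blast+
  have finE: "finite E" using EH H.finite_edges finite_subset by blast
  obtain g :: "'b \<Rightarrow> nat" where g: "inj_on g E"
    using finite_imp_inj_to_nat_seg[OF finE] by auto
  define S where "S = \<lparr>verts = V, edges = E, ends = ends H\<rparr>"
  define T where "T = \<lparr>verts = f ` V, edges = g ` E, ends = (\<lambda>n. f ` ends H (inv_into E g n))\<rparr>"
  have endsT: "ends T (g x) = f ` ends H x" if "x \<in> E" for x
    unfolding T_def using g that by simp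
  have S: "subgraph S H"
    unfolding subgraph_def S_def
    using VH EH finV finE H.card_ends by (auto intro!: multigraph.intro dest: subsetD[OF EV])
  have T: "multigraph T"
  proof
    show "finite (verts T)" "finite (edges T)" using finV finE by (auto simp: T_def)
  next
    fix n assume "n \<in> edges T"
    then obtain x where x: "x \<in> E" "n = g x" by (auto simp: T_def)
    show "ends T n \<subseteq> verts T" 
      unfolding x(2) endsT[OF x(1)] using EV[OF x(1)] by (simp add: T_def image_mono)
    have "card (f ` ends H x) = card (ends H x)"
      by (rule card_image, rule inj_on_subset[OF injf EV[OF x(1)]])
    then show "card (ends T n) = 2" 
      unfolding x(2) endsT[OF x(1)] using x(1) H.card_ends EH by auto
  qed
  have iso: "isomorphic S T"
    unfolding isomorphic_def
  proof (intro exI conjI ballI)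
    show "bij_betw f (verts S) (verts T)" "bij_betw g (edges S) (edges T)"
      using injf g by (auto simp: S_def T_def bij_betw_def)
    show "ends T (g e) = f ` ends S e" if "e \<in> edges S" for e
      using that endsT by (simp add: S_def)
  qed
  define P where "P e = (map f (L e), map g (le e))" for e
  have fV: "f ` A \<inter> f ` B = f ` (A \<inter> B)" if "A \<subseteq> V" "B \<subseteq> V" for A B
    using inj_on_image_Int[OF injf that] by simp
  have hV: "h ` verts K \<subseteq> V" unfolding V_def by blast
  have fhI: "f ` h ` A = A" if "A \<subseteq> verts K" for A
    unfolding image_image using that fh by (simp cong: image_cong add: subset_iff)
  have Kends: "ends K e \<subseteq> verts K" if "e \<in> edges K" for e using that K.ends_in_verts by blast
  have sub: "subdivision_by K P T"
    unfolding subdivision_by_def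
  proof (intro conjI ballI impI T)
    fix e assume e: "e \<in> edges K"
    have seq: "set (le e) \<subseteq> E" using e unfolding E_def by blast
    show "is_path T (P e)"
      unfolding is_path_def P_def prod.case
    proof (intro conjI allI impI)
      show "length (map f (L e)) = length (map g (le e)) + 1"
        using len[OF e] by (simp add: le_def)
      show "distinct (map f (L e))"
        using L[OF e] inj_on_subset[OF injf LV[OF e]] by (simp add: distinct_map)
      show "set (map f (L e)) \<subseteq> verts T" using LV[OF e] by (auto simp: T_def)
      show "set (map g (le e)) \<subseteq> edges T" using seq by (auto simp: T_def)
      fix i assume "i < length (map g (le e))"
      then have i: "i < length (L e) - 1" by (simp add: le_def)
      then have "le e ! i = ed {L e ! i, L e ! Suc i}" "i < length (le e)" by (auto simp: le_def)
      moreover have "le e ! i \<in> E" using seq calculation(2) by auto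
      ultimately show "ends T (map g (le e) ! i) = {map f (L e) ! i, map f (L e) ! Suc i}"
        using endsT ed[OF adjL[OF e i]] i by simp
    qed
    show "snd (P e) \<noteq> []" using len[OF e] by (simp add: P_def le_def)
    have "{hd (fst (P e)), last (fst (P e))} = f ` {hd (L e), last (L e)}"
      using conjunct1[OF conjunct2[OF conjunct2[OF L[OF e]]]] by (simp add: P_def hd_map last_map)
    also have "\<dots> = f ` h ` ends K e" using L[OF e] by presburger
    finally show "{hd (fst (P e)), last (fst (P e))} = ends K e"
      using fhI[OF Kends[OF e]] by simp
    have "set (fst (P e)) \<inter> verts K = f ` set (L e) \<inter> f ` h ` verts K"
      using fhI by (simp add: P_def)
    also have "\<dots> = f ` (set (L e) \<inter> h ` verts K)" using fV[OF LV[OF e] hV] .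
    also have "\<dots> = f ` h ` ends K e" using L[OF e] by presburger
    finally show "set (fst (P e)) \<inter> verts K = ends K e"
      using fhI[OF Kends[OF e]] by simp
    fix e' assume e': "e' \<in> edges K" and ne: "e \<noteq> e'"
    have "set (fst (P e)) \<inter> set (fst (P e')) = f ` (set (L e) \<inter> set (L e'))"
      using fV[OF LV[OF e] LV[OF e']] by (simp add: P_def)
    also have "\<dots> \<subseteq> f ` h ` (ends K e \<inter> ends K e')" by (rule image_mono[OF disj[OF e e' ne]])
    also have "\<dots> = ends K e \<inter> ends K e'" by (rule fhI) (use Kends[OF e] in auto)
    finally show "set (fst (P e)) \<inter> set (fst (P e')) \<subseteq> ends K e \<inter> ends K e'" .
    \<comment> \<open>A shared edge would have both ends in the image of
      \<open>ends K e \<inter> ends K e'\<close>, which has at most one element by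
      \<open>simple\<close>.\<close>
    have "False" if x: "x \<in> set (le e)" "x \<in> set (le e')" for x
    proof -
      have "ends H x \<subseteq> h ` (ends K e \<inter> ends K e')"
        using conjunct2[OF le[OF e x(1)]] conjunct2[OF le[OF e' x(2)]] disj[OF e e' ne]
        by (meson Int_greatest subset_trans)
      moreover have fin: "finite (ends K e \<inter> ends K e')"
        using finite_subset[OF Kends[OF e] K.finite_verts] by simp
      ultimately have "card (ends H x) \<le> card (h ` (ends K e \<inter> ends K e'))"
        by (intro card_mono) auto
      also have "\<dots> \<le> 1" using card_image_le[OF fin, of h] simple[OF e e' ne] by simp
      finally show False using H.card_ends le[OF e x(1)] by simp
    qed
    moreover have "set (le e') \<subseteq> E" using e' unfolding E_def by blast
    ultimately show "set (snd (P e)) \<inter> set (snd (P e')) = {}"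
      using seq g by (auto simp: P_def dest: inj_onD)
  next
    have "f ` V = f ` h ` verts K \<union> (\<Union>e\<in>edges K. f ` set (L e))"
      unfolding V_def by (simp add: image_Un image_UN)
    then show "verts T = verts K \<union> (\<Union>e\<in>edges K. set (fst (P e)))"
      using fhI by (simp add: T_def P_def)
    show "edges T = (\<Union>e\<in>edges K. set (snd (P e)))"
      by (auto simp: T_def P_def E_def)
  qed
  have "odd (length (snd (P e)))" if "e \<in> edges K" for e
    using L[OF that] len[OF that] by (simp add: P_def le_def)
  then show ?thesis
    using S iso sub unfolding totally_odd_subdivision_def by blast
qed

text \<open>A totally odd subdivision of \<open>C\<^sub>5\<^sup>+\<close> is the same as a theta graph with one even and two odd
  paths, one of the odd ones having length at least three. Below, \<open>a\<close> and \<open>b\<close> are the branch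
  vertices (2 and 5); \<open>p\<close> plays vertex 1, and \<open>r\<close>, \<open>r'\<close> play 3 and 4.\<close>

lemma theta_not_odd_C5plus_free:
  fixes H :: "('a, 'b) pre_multigraph"
  assumes H: "multigraph H"
    and dist: "distinct (a # b # p # P @ Q @ r # r' # R)"
    and par: "even (length P)" "even (length Q)" "even (length R)"
    and paths: "successively (adjacent H) (a # p # P @ [b])"
      "successively (adjacent H) (a # Q @ [b])"
      "successively (adjacent H) (a # r # r' # R @ [b])"
  shows "\<not> odd_C5plus_free H"
proof -
  define h :: "nat \<Rightarrow> 'a" where
    "h i = (if i = 1 then p else if i = 2 then a else if i = 3 then r else if i = 4 then r' else b)" for i
  \<comment> \<open>The even path through \<open>p\<close> is cut at \<open>p\<close> into the edges
    12 and 15, and the path through \<open>r\<close>, \<open>r'\<close> is cut into 23, 34 and 45;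
    \<open>Q\<close> yields 25.\<close>
  define L :: "nat set \<Rightarrow> 'a list" where
    "L e = (if e = {1,2} then [a, p] else if e = {2,3} then [a, r] else if e = {3,4} then [r, r']
       else if e = {4,5} then r' # R @ [b] else if e = {1,5} then p # P @ [b] else a # Q @ [b])" for e
  have hs: "h 1 = p" "h (Suc 0) = p" "h 2 = a" "h 3 = r" "h 4 = r'" "h 5 = b"
    by (auto simp: h_def)
  have Ls: "L {1,2} = [a, p]" "L {2,3} = [a, r]" "L {3,4} = [r, r']"
    "L {4,5} = r' # R @ [b]" "L {1,5} = p # P @ [b]" "L {2,5} = a # Q @ [b]"
    by (simp_all add: L_def doubleton_eq_iff)
  \<comment> \<open>The same equations in simplifier normal form, where \<open>1\<close> becomes
    \<open>Suc 0\<close>.\<close>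
  have Ls: "L {Suc 0,2} = [a, p]" "L {2,3} = [a, r]" "L {3,4} = [r, r']"
    "L {4,5} = r' # R @ [b]" "L {Suc 0,5} = p # P @ [b]" "L {2,5} = a # Q @ [b]"
    using Ls by simp_all
  have adj: "v \<in> verts H" "u \<in> verts H" if "adjacent H u v" for u v
    using that multigraph.ends_in_verts[OF H] unfolding adjacent_def by fastforce+
  have K: "multigraph C5plus"
    by unfold_locales (auto simp: C5plus_def)
  have E: "edges C5plus = {{Suc 0,2},{2,3},{3,4},{4,5},{Suc 0,5},{2,5}}" "ends C5plus = (\<lambda>e. e)"
    "verts C5plus = {Suc 0,2,3,4,5}" by (auto simp: C5plus_def)
  have last: "adjacent H (last xs) y" if "successively (adjacent H) (xs @ [y])" "xs \<noteq> []" for xs y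
    using that by (simp add: successively_append_iff)
  have s: "successively (adjacent H) (p # P @ [b])" "adjacent H a p"
    "successively (adjacent H) (r' # R @ [b])" "adjacent H a r" "adjacent H r r'"
    using paths by auto
  have b: "b \<in> verts H" using last[of "p # P" b] s adj by auto
  have "\<exists>S (T :: (nat, nat) pre_multigraph).
      subgraph S H \<and> totally_odd_subdivision C5plus T \<and> isomorphic S T"
  proof (rule totally_odd_subdivision_in_graph[OF H K, where h = h and L = L], goal_cases)
    case (1 e f)
    then show ?case unfolding E by (auto simp: doubleton_eq_iff)
  next
    case 2
    show ?case unfolding E using dist by (auto simp: inj_on_def hs)
  next
    case 3
    show ?case unfolding E using adj s b by (auto simp: hs)
  next
    case (4 e)
    have ne: "p \<noteq> b" "r' \<noteq> b" using dist by auto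
    consider "e = {Suc 0, 2}" | "e = {2, 3}" | "e = {3, 4}" | "e = {4, 5}" | "e = {Suc 0, 5}" | "e = {2, 5}"
      using 4 unfolding E by blast
    then show ?case unfolding E
      by cases (use dist ne par paths(2) s in \<open>simp_all add: hs Ls insert_commute Int_insert_left\<close>)
  next
    case (5 e f)
    from 5 show ?case unfolding E
      by (elim insertE emptyE; hypsubst) (use dist in \<open>simp_all add: hs Ls disjoint_iff, auto?\<close>)
  qed
  then show ?thesis by (simp add: odd_C5plus_free_def)
qed

lemma adjacent_commute: "adjacent G u v \<longleftrightarrow> adjacent G v u"
  by (simp add: adjacent_def insert_commute)

lemma successively_adjacent_rev:
  "successively (adjacent G) (rev xs) \<longleftrightarrow> successively (adjacent G) xs"
  by (simp add: adjacent_commute)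

text \<open>A nonempty list of even length has at least two elements, so whichever of
  \<open>Q\<close> and \<open>R\<close> is nonempty supplies the path of length at least
  three.\<close>

lemma no_theta:
  assumes H: "multigraph H" and free: "odd_C5plus_free H"
    and dist: "distinct (a # b # P @ Q @ R)"
    and par: "odd (length P)" "even (length Q)" "even (length R)"
    and ne: "Q \<noteq> [] \<or> R \<noteq> []"
    and paths: "successively (adjacent H) (a # P @ [b])"
      "successively (adjacent H) (a # Q @ [b])" "successively (adjacent H) (a # R @ [b])"
  shows False
proof -
  obtain p P' where P: "P = p # P'" using par(1) by (cases P) auto
  have split: "\<exists>r r' R'. xs = r # r' # R'" if "xs \<noteq> []" "even (length xs)" for xs :: "'a list"
    using that by (cases xs; cases "tl xs"; auto)
  show False
  proof (cases "R = []")
    case False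
    then obtain r r' R' where R: "R = r # r' # R'" using split par by blast
    then show False
      using theta_not_odd_C5plus_free[OF H, of a b p P' Q r r' R'] free dist par paths P by simp
  next
    case True
    then obtain r r' R' where Q: "Q = r # r' # R'" using split ne par by blast
    then show False
      using theta_not_odd_C5plus_free[OF H, of a b p P' R r r' R'] free dist par paths P True by simp
  qed
qed

section \<open>Odd cycles have no chords and no odd ears\<close>

definition odd_cycle :: "('a, 'b) pre_multigraph \<Rightarrow> (nat \<Rightarrow> 'a) \<Rightarrow> nat \<Rightarrow> bool" where
  "odd_cycle G v s \<longleftrightarrow> s \<ge> 1 \<and> inj_on v {..2 * s} \<and>
     (\<forall>i<2 * s. adjacent G (v i) (v (Suc i))) \<and> adjacent G (v (2 * s)) (v 0)"

lemma successively_map_upt: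
  "successively P (map f [m..<n]) \<longleftrightarrow> (\<forall>i. m \<le> i \<and> Suc i < n \<longrightarrow> P (f i) (f (Suc i)))"
proof -
  have "(\<forall>i. Suc i < n - m \<longrightarrow> P (f (m + i)) (f (Suc (m + i)))) \<longleftrightarrow>
      (\<forall>i. m \<le> i \<and> Suc i < n \<longrightarrow> P (f i) (f (Suc i)))"
    by (auto simp: le_iff_add)
  then show ?thesis by (auto simp: successively_conv_nth)
qed

text \<open>The ear and the two arcs between its ends form a theta graph. The arcs have opposite
  parities and the ear is odd; \<open>nontriv\<close> rules out an ear parallel to an edge of the
  cycle, which would leave both odd paths with length one.\<close>

lemma no_odd_ear_list:
  assumes H: "multigraph H" and free: "odd_C5plus_free H" and C: "odd_cycle H v s"
    and ij: "i < j" "j \<le> 2 * s"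
    and ear: "distinct es" "set es \<inter> v ` {..2 * s} = {}" "even (length es)"
      "successively (adjacent H) (v i # es @ [v j])"
    and nontriv: "es = [] \<Longrightarrow> j \<noteq> Suc i \<and> \<not> (i = 0 \<and> j = 2 * s)"
  shows False
proof -
  have inj: "inj_on v {..2 * s}" and adj: "\<And>i. i < 2 * s \<Longrightarrow> adjacent H (v i) (v (Suc i))"
    and adj0: "adjacent H (v (2 * s)) (v 0)"
    using C unfolding odd_cycle_def by auto
  define A where "A = map v [Suc i..<j]"
  \<comment> \<open>The arc from \<open>v j\<close> to \<open>v i\<close> through the closing edge;
    it is reversed below so that all three paths start at \<open>v i\<close>.\<close>
  define B where "B = map v [Suc j..<Suc (2 * s)] @ map v [0..<i]"
  have upt: "map v [i..<Suc j] = v i # A @ [v j]"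
    using ij unfolding A_def by (simp add: upt_conv_Cons)
  have sA: "successively (adjacent H) (v i # A @ [v j])"
    unfolding upt[symmetric] successively_map_upt using adj ij by auto
  have "[j..<Suc (2 * s)] = j # [Suc j..<Suc (2 * s)]" using ij by (intro upt_conv_Cons) simp
  then have B1: "map v [j..<Suc (2 * s)] @ map v [0..<Suc i] = v j # B @ [v i]"
    unfolding B_def by (simp only: upt_Suc) simp
  have "last (map v [j..<Suc (2 * s)]) = v (2 * s)" using ij by simp
  moreover have "hd (map v [0..<Suc i]) = v 0" by (simp add: hd_map del: upt_Suc)
  ultimately have "successively (adjacent H) (v j # B @ [v i])"
    unfolding B1[symmetric] successively_append_iff successively_map_upt
    using adj adj0 ij by (simp del: upt_Suc)
  then have sB: "successively (adjacent H) (v i # rev B @ [v j])"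
    by (subst (asm) successively_adjacent_rev[symmetric]) simp
  have len: "length A = j - Suc i" "length (rev B) = 2 * s - j + i"
    unfolding A_def B_def using ij by auto
  have sub: "set xs \<subseteq> {..2 * s} \<Longrightarrow> distinct xs \<Longrightarrow> distinct (map v xs)" for xs
    using inj by (auto simp: distinct_map intro: inj_on_subset)
  have "v i # v j # A @ rev B = map v (i # j # [Suc i..<j] @ rev ([Suc j..<Suc (2 * s)] @ [0..<i]))"
    unfolding A_def B_def by (simp add: rev_map)
  moreover have "distinct (map v (i # j # [Suc i..<j] @ rev ([Suc j..<Suc (2 * s)] @ [0..<i])))"
    by (rule sub) (use ij in auto)
  ultimately have d: "distinct (v i # v j # A @ rev B)" by simp
  have "set A \<subseteq> v ` {..2 * s}" "set B \<subseteq> v ` {..2 * s}" "v i \<in> v ` {..2 * s}" "v j \<in> v ` {..2 * s}"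
    unfolding A_def B_def using ij by auto
  then have e: "set es \<inter> set A = {}" "set es \<inter> set B = {}" "v i \<notin> set es" "v j \<notin> set es"
    using ear(2) by blast+
  show False
  \<comment> \<open>The lengths of \<open>A\<close> and \<open>B\<close> add up to
    \<open>2 * s - 1\<close>, so exactly one is odd; that arc is the even path of the theta
    graph.\<close>
  proof (cases "odd (length A)")
    case True
    then have "even (length (rev B))" using len ij by presburger
    moreover have "rev B \<noteq> [] \<or> es \<noteq> []" using len nontriv True ij by fastforce
    ultimately show False
      using no_theta[OF H free _ True _ ear(3) _ sA sB ear(4)] d e ear(1) by auto
  next
    case False
    then have odd: "odd (length (rev B))" using len ij by presburger
    have "A \<noteq> [] \<or> es \<noteq> []" using len nontriv False ij by fastforce
    then show False
      using no_theta[OF H free _ odd _ ear(3) _ sB sA ear(4)] d e ear(1) False by auto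
  qed
qed

lemma odd_cycle_no_chord:
  assumes H: "multigraph H" and free: "odd_C5plus_free H" and C: "odd_cycle H v s"
    and ij: "i < j" "j \<le> 2 * s" and adj: "adjacent H (v i) (v j)"
  shows "j = Suc i \<or> i = 0 \<and> j = 2 * s"
proof (rule ccontr)
  assume "\<not> (j = Suc i \<or> i = 0 \<and> j = 2 * s)"
  then show False using no_odd_ear_list[OF H free C ij, of "[]"] adj by simp
qed

text \<open>The form needed for walks given by functions. The ends may occur on the cycle in either
  order, so the ear is reversed if necessary.\<close>

lemma odd_cycle_no_odd_ear:
  assumes H: "multigraph H" and free: "odd_C5plus_free H" and C: "odd_cycle H v s"
    and im: "Suc i < m" "odd (m - i)" and inj: "inj_on u {i..m}"
    and W: "u i \<in> v ` {..2 * s}" "u m \<in> v ` {..2 * s}" "\<And>n. i < n \<Longrightarrow> n < m \<Longrightarrow> u n \<notin> v ` {..2 * s}"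
    and adj: "\<And>n. i \<le> n \<Longrightarrow> n < m \<Longrightarrow> adjacent H (u n) (u (Suc n))"
  shows False
proof -
  define es where "es = map u [Suc i..<m]"
  obtain a b where a: "a \<le> 2 * s" "u i = v a" and b: "b \<le> 2 * s" "u m = v b" using W by auto
  have "u i \<noteq> u m" using inj im by (auto dest!: inj_onD[where x = i and y = m])
  then have "a \<noteq> b" using a b by auto
  have upt: "map u [i..<Suc m] = v a # es @ [v b]"
    using im a b unfolding es_def by (simp add: upt_conv_Cons)
  have es: "distinct es" "set es \<inter> v ` {..2 * s} = {}" "even (length es)" "es \<noteq> []"
    "successively (adjacent H) (v a # es @ [v b])"
  proof -
    show "distinct es" unfolding es_def using inj by (auto simp: distinct_map intro: inj_on_subset)
    show "set es \<inter> v ` {..2 * s} = {}" unfolding es_def using W(3) by (auto simp: Suc_le_eq image_iff disjoint_iff)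
    show "even (length es)" "es \<noteq> []" unfolding es_def using im by auto
    show "successively (adjacent H) (v a # es @ [v b])"
      unfolding upt[symmetric] successively_map_upt using adj by auto
  qed
  show False
  proof (cases "a < b")
    case True
    then show False using no_odd_ear_list[OF H free C True b(1) es(1-3,5)] es(4) by simp
  next
    case False
    then have "b < a" using \<open>a \<noteq> b\<close> by simp
    moreover have "successively (adjacent H) (v b # rev es @ [v a])"
      using es(5) by (subst successively_adjacent_rev[symmetric]) simp
    ultimately show False using no_odd_ear_list[OF H free C _ a(1), of b "rev es"] es by simp
  qed
qed

section \<open>Kempe chains\<close>

text \<open>The Kempe chain from \<open>x\<close>: \<open>p\<close> and \<open>q\<close> move along the edge of the respective colour and fix
  the vertices missing that colour, so that the chain ends where the walk becomes stationary.\<close>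

fun alternate :: "('a \<Rightarrow> 'a) \<Rightarrow> ('a \<Rightarrow> 'a) \<Rightarrow> 'a \<Rightarrow> nat \<Rightarrow> 'a" where
  "alternate p q x 0 = x"
| "alternate p q x (Suc n) = (if even n then q else p) (alternate p q x n)"

lemma alternate_in:
  assumes "x \<in> V" "p ` V \<subseteq> V" "q ` V \<subseteq> V"
  shows "alternate p q x n \<in> V"
  using assms by (induction n) auto

text \<open>In a finite set the walk must repeat a vertex, and for involutions with
  \<open>p x = x\<close> a repetition forces an earlier stationary step. Before the first such step
  the walk is injective, and there it has exhausted the component of \<open>x\<close>.\<close>

lemma alternate_path:
  assumes V: "finite V" "x \<in> V" "p ` V \<subseteq> V" "q ` V \<subseteq> V"
    and p: "\<And>z. p (p z) = z" and q: "\<And>z. q (q z) = z" and px: "p x = x"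
  obtains N where "inj_on (alternate p q x) {..N}"
    "\<And>v. v \<in> alternate p q x ` {..N} \<Longrightarrow> p v \<in> alternate p q x ` {..N} \<and> q v \<in> alternate p q x ` {..N}"
proof -
  define w where "w = alternate p q x"
  have w0: "w 0 = x" and wS: "w (Suc n) = (if even n then q else p) (w n)" for n
    by (simp_all add: w_def)
  have prev: "(if even n then q else p) (w (Suc n)) = w n" for n
    using p q by (simp add: wS)
  \<comment> \<open>With \<open>j = Suc j'\<close>, equal parities of \<open>i\<close> and
    \<open>j'\<close> let the coincidence shrink from both sides to \<open>Suc i\<close> and
    \<open>j'\<close>. Otherwise both walks are moved one step back, and at \<open>i = 0\<close> the
    fixed point of \<open>p\<close> makes step \<open>j'\<close> stationary.\<close>
  have collide: "\<exists>m. m < j \<and> w (Suc m) = w m" if "w i = w j" "i < j" for i j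
    using that
  proof (induction j arbitrary: i rule: less_induct)
    case (less j)
    obtain j' where j: "j = Suc j'" using less.prems(2) by (cases j) auto
    show ?case
    proof (cases "even i = even j'")
      case True
      then have eq: "w (Suc i) = w j'" using prev[of j'] less.prems(1) j wS[of i] by simp
      have "i = j' \<or> Suc i < j'"
        using less.prems(2) j True by (cases "i = j'"; cases "Suc i = j'") auto
      then show ?thesis
      proof
        assume "i = j'"
        then show ?thesis using less.prems(1) j by auto
      next
        assume "Suc i < j'"
        then obtain m where "m < j'" "w (Suc m) = w m" using less.IH[of j' "Suc i"] eq j by auto
        then show ?thesis using j less_SucI by blast
      qed
    next
      case False
      show ?thesis
      proof (cases i)
        case 0
        then have "w (Suc j') = w j'" using prev[of j'] less.prems(1) False j px w0 by simp
        then show ?thesis using j by blast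
      next
        case (Suc i')
        then have "even i' = even j'" using False by simp
        then have "w i' = w j'" using prev[of j'] prev[of i'] less.prems(1) j Suc by simp
        then obtain m where "m < j'" "w (Suc m) = w m"
          using less.IH[of j' i'] less.prems(2) j Suc by auto
        then show ?thesis using j less_SucI by blast
      qed
    qed
  qed
  have "range w \<subseteq> V" unfolding w_def using alternate_in[OF V(2-4)] by blast
  then have "\<not> inj w" using finite_subset[OF _ V(1)] finite_imageD[of w UNIV] by auto
  then obtain i j where "w i = w j" "i < j"
    using linorder_injI[of w] by (metis linorder_neqE_nat)
  then have ex: "\<exists>m. w (Suc m) = w m" using collide by blast
  define N where "N = (LEAST m. w (Suc m) = w m)"
  have N: "w (Suc N) = w N" unfolding N_def using ex by (rule LeastI_ex)
  have least: "w (Suc m) \<noteq> w m" if "m < N" for m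
    using that not_less_Least unfolding N_def by blast
  show thesis
  proof (rule that)
    show "inj_on (alternate p q x) {..N}"
      unfolding w_def[symmetric]
    proof (rule linorder_inj_onI')
      fix i j assume ij: "i \<in> {..N}" "j \<in> {..N}" "i < j"
      show "w i \<noteq> w j"
      proof
        assume "w i = w j"
        then obtain m where "m < j" "w (Suc m) = w m" using collide ij(3) by blast
        then show False using least[of m] ij(2) by simp
      qed
    qed
  next
    fix v assume "v \<in> alternate p q x ` {..N}"
    then obtain i where i: "i \<le> N" "v = w i" unfolding w_def by auto
    have next_in: "w (Suc i) \<in> w ` {..N}"
    proof (cases "i = N")
      case True
      then show ?thesis using N by simp
    next
      case False
      then show ?thesis using i by (intro imageI) simp
    qed
    \<comment> \<open>The start has no predecessor; there \<open>p x = x\<close> takes its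
      place.\<close>
    have prev_in: "(if even i then p else q) (w i) \<in> w ` {..N}"
    proof (cases i)
      case 0
      then show ?thesis using px w0 by (auto intro: image_eqI[of _ _ 0])
    next
      case (Suc n)
      then have "(if even i then p else q) (w i) = w n" using prev[of n] by (cases "even n") auto
      then show ?thesis using i Suc by auto
    qed
    show "p v \<in> alternate p q x ` {..N} \<and> q v \<in> alternate p q x ` {..N}"
      unfolding w_def[symmetric] using next_in prev_in i(2) wS[of i] by (cases "even i") auto
  qed
qed

text \<open>The colour not used to leave the odd cycle has all its edges at the cycle inside, so a chain
  could only return through the colour it left with, and would form an odd ear.\<close>

lemma alternate_no_return:
  assumes H: "multigraph H" and free: "odd_C5plus_free H" and C: "odd_cycle H v s"
    and p: "\<And>z. p (p z) = z" "\<And>z. p z \<noteq> z \<Longrightarrow> adjacent H z (p z)"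
    and q: "\<And>z. q (q z) = z" "\<And>z. q z \<noteq> z \<Longrightarrow> adjacent H z (q z)"
    and inj: "inj_on (alternate p q x) {..N}" and ij: "i < j" "j \<le> N"
    and W: "alternate p q x i \<in> v ` {..2 * s}" "alternate p q x (Suc i) \<notin> v ` {..2 * s}"
    and closed: "\<And>z. z \<in> v ` {..2 * s} \<Longrightarrow> (if even i then p else q) z \<in> v ` {..2 * s}"
  shows "alternate p q x j \<notin> v ` {..2 * s}"
proof
  define w where "w = alternate p q x"
  have wS: "w (Suc n) = (if even n then q else p) (w n)" for n by (simp add: w_def)
  let ?W = "v ` {..2 * s}"
  note inj = inj[folded w_def] and W = W[folded w_def]
  assume "alternate p q x j \<in> ?W"
  then have jW: "w j \<in> ?W" by (simp add: w_def)
  define m where "m = (LEAST m. i < m \<and> w m \<in> ?W)"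
  have m: "i < m \<and> w m \<in> ?W" unfolding m_def by (rule LeastI[of _ j]) (use ij jW in simp)
  have mj: "m \<le> j" unfolding m_def by (rule Least_le) (use ij jW in simp)
  have least: "w n \<notin> ?W" if "i < n" "n < m" for n
    using that not_less_Least[of n "\<lambda>m. i < m \<and> w m \<in> ?W"] unfolding m_def by blast
  obtain n where n: "m = Suc n" using m by (cases m) auto
  have Sm: "Suc i < m" using m W(2) by (cases "m = Suc i") auto
  then have nW: "w n \<notin> ?W" using least[of n] n by simp
  have wm: "w m = (if even n then q else p) (w n)" using wS n by simp
  \<comment> \<open>The step re-entering the cycle has the same type as the step leaving it, because
    the other involution preserves the cycle.\<close>
  then have "even i = even n"
    using closed[of "w m"] m nW p(1) q(1) by (cases "even n"; cases "even i") auto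
  then have odd: "odd (m - i)" using n m by auto
  have adj: "adjacent H (w a) (w (Suc a))" if a: "i \<le> a" "a < m" for a
  proof -
    have "w a \<noteq> w (Suc a)" using inj_onD[OF inj, of a "Suc a"] a mj ij by auto
    then show ?thesis using p(2)[of "w a"] q(2)[of "w a"] wS[of a] by (cases "even a") auto
  qed
  have "inj_on w {i..m}" using inj by (rule inj_on_subset) (use mj ij in auto)
  from odd_cycle_no_odd_ear[OF H free C Sm odd this W(1) _ least adj] m show False by blast
qed

text \<open>The default \<open>v\<close> makes this a total involution for proper colourings, and
  turns "\<open>v\<close> misses colour \<open>a\<close>" into a fixed-point equation.\<close>

definition partner ::
  "('a, 'b) pre_multigraph \<Rightarrow> 'b set \<Rightarrow> ('b \<Rightarrow> nat) \<Rightarrow> nat \<Rightarrow> 'a \<Rightarrow> 'a" where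
  "partner G F c a v =
     (if \<exists>e\<in>F. c e = a \<and> v \<in> ends G e
      then SOME u. \<exists>e\<in>F. c e = a \<and> v \<in> ends G e \<and> ends G e = {v, u} else v)"

lemma partner_cong:
  assumes "\<And>e. e \<in> F \<Longrightarrow> v \<in> ends G e \<Longrightarrow> c e = a \<longleftrightarrow> c' e = a'"
  shows "partner G F c a v = partner G F c' a' v"
proof -
  have "(\<exists>e\<in>F. c e = a \<and> v \<in> ends G e \<and> P e) \<longleftrightarrow> (\<exists>e\<in>F. c' e = a' \<and> v \<in> ends G e \<and> P e)" for P
    using assms by blast
  from this[of "\<lambda>_. True"] this[of "\<lambda>e. ends G e = {v, u}" for u] show ?thesis
    unfolding partner_def by auto
qed

text \<open>A partial colouring: \<open>F\<close> is the set of edges coloured so far, and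
  \<open>c\<close> is constrained only there.\<close>

locale edge_colouring = multigraph G for G :: "('a, 'b) pre_multigraph" +
  fixes F :: "'b set" and c :: "'b \<Rightarrow> nat" and k :: nat
  assumes coloured: "F \<subseteq> edges G"
    and colours: "\<And>e. e \<in> F \<Longrightarrow> c e < k"
    and proper: "\<And>e f. e \<in> F \<Longrightarrow> f \<in> F \<Longrightarrow> e \<noteq> f \<Longrightarrow> ends G e \<inter> ends G f \<noteq> {} \<Longrightarrow> c e \<noteq> c f"
begin

lemma ends_pair:
  assumes "e \<in> edges G" "v \<in> ends G e"
  obtains u where "ends G e = {v, u}" "u \<noteq> v"
proof -
  obtain a b where ab: "ends G e = {a, b}" "a \<noteq> b"
    using card_ends[OF assms(1)] unfolding card_2_iff by blast
  show thesis
  proof (cases "v = a")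
    case True
    then show thesis using that[of b] ab by simp
  next
    case False
    then have "v = b" using ab(1) assms(2) by simp
    then show thesis using that[of a] ab by (simp add: insert_commute)
  qed
qed

lemma partner_edge:
  assumes "e \<in> F" "ends G e = {v, u}"
  shows "partner G F c (c e) v = u"
proof -
  have "u' = u" if "f \<in> F" "c f = c e" "ends G f = {v, u'}" for f u'
  proof -
    have "f = e" using proper[OF that(1) assms(1)] that(2,3) assms(2) by auto
    then show ?thesis using that(3) assms(2) by (auto simp: doubleton_eq_iff)
  qed
  then have "(SOME u. \<exists>f\<in>F. c f = c e \<and> v \<in> ends G f \<and> ends G f = {v, u}) = u"
    using assms by (intro some_equality) blast+
  moreover have "\<exists>f\<in>F. c f = c e \<and> v \<in> ends G f" using assms by auto
  ultimately show ?thesis unfolding partner_def by simp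
qed

lemma edge_partner:
  assumes "partner G F c a v \<noteq> v"
  obtains e where "e \<in> F" "c e = a" "ends G e = {v, partner G F c a v}"
proof -
  obtain e where e: "e \<in> F" "c e = a" "v \<in> ends G e"
    using assms unfolding partner_def by (auto split: if_splits)
  then obtain u where u: "ends G e = {v, u}" using ends_pair[OF subsetD[OF coloured]] by metis
  then show thesis using that[OF e(1,2)] e partner_edge[OF e(1) u] by simp
qed

lemma partner_neq: "e \<in> F \<Longrightarrow> v \<in> ends G e \<Longrightarrow> partner G F c (c e) v \<noteq> v"
  using ends_pair[OF subsetD[OF coloured]] partner_edge by metis

lemma partner_partner [simp]: "partner G F c a (partner G F c a v) = v"
proof (cases "partner G F c a v = v")
  case False
  then obtain e where "e \<in> F" "c e = a" "ends G e = {v, partner G F c a v}" by (rule edge_partner)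
  then show ?thesis using partner_edge[of e "partner G F c a v" v] by (simp add: insert_commute)
qed simp

lemma partner_adjacent: "partner G F c a v \<noteq> v \<Longrightarrow> adjacent G v (partner G F c a v)"
  using edge_partner coloured unfolding adjacent_def by blast

lemma partner_verts: "partner G F c a ` verts G \<subseteq> verts G"
proof (rule image_subsetI)
  fix v assume "v \<in> verts G"
  then show "partner G F c a v \<in> verts G"
    using partner_adjacent[of a v] ends_in_verts unfolding adjacent_def by fastforce
qed

section \<open>Swapping two colours on Kempe-closed sets\<close>

definition swap_colours :: "'a set \<Rightarrow> nat \<Rightarrow> nat \<Rightarrow> 'b \<Rightarrow> nat" where
  "swap_colours K a b e =
     (if ends G e \<subseteq> K \<and> c e = a then b else if ends G e \<subseteq> K \<and> c e = b then a else c e)"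

text \<open>Such a set is a union of components of the subgraph formed by the colours
  \<open>a\<close> and \<open>b\<close>; connectedness is not demanded.\<close>

definition kempe_closed :: "'a set \<Rightarrow> nat \<Rightarrow> nat \<Rightarrow> bool" where
  "kempe_closed K a b \<longleftrightarrow> (\<forall>v\<in>K. partner G F c a v \<in> K \<and> partner G F c b v \<in> K)"

lemma kempe_closed_edge:
  assumes "kempe_closed K a b" "e \<in> F" "v \<in> ends G e" "v \<in> K" "c e = a \<or> c e = b"
  shows "ends G e \<subseteq> K"
proof -
  obtain u where u: "ends G e = {v, u}" using ends_pair[OF subsetD[OF coloured]] assms(2,3) by metis
  then have "u = partner G F c (c e) v" using partner_edge assms by simp
  then show ?thesis using u assms unfolding kempe_closed_def by auto
qed

text \<open>An edge of colour \<open>a\<close> or \<open>b\<close> meeting \<open>K\<close> lies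
  inside \<open>K\<close>, so a single end decides whether it is recoloured.\<close>

lemma swap_colours_at:
  assumes K: "kempe_closed K a b" and e: "e \<in> F" "v \<in> ends G e"
  shows "swap_colours K a b e =
    (if v \<in> K \<and> c e = a then b else if v \<in> K \<and> c e = b then a else c e)"
proof (cases "v \<in> K \<and> (c e = a \<or> c e = b)")
  case True
  then have "ends G e \<subseteq> K" using kempe_closed_edge[OF K e] by blast
  then show ?thesis using True by (simp add: swap_colours_def)
next
  case False
  then show ?thesis using e(2) by (auto simp: swap_colours_def)
qed

lemma partner_swap:
  assumes K: "kempe_closed K a b" and ab: "a \<noteq> b"
  shows "partner G F (swap_colours K a b) a v = partner G F c (if v \<in> K then b else a) v"
    and "partner G F (swap_colours K a b) b v = partner G F c (if v \<in> K then a else b) v"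
    and "d \<noteq> a \<Longrightarrow> d \<noteq> b \<Longrightarrow> partner G F (swap_colours K a b) d v = partner G F c d v"
  by (rule partner_cong, use ab in \<open>auto simp: swap_colours_at[OF K]\<close>)+

lemma swap_colouring:
  assumes K: "kempe_closed K a b" and ab: "a < k" "b < k"
  shows "edge_colouring G F (swap_colours K a b) k"
proof
  show "F \<subseteq> edges G" by (rule coloured)
  show "swap_colours K a b e < k" if "e \<in> F" for e
    using colours[OF that] ab by (simp add: swap_colours_def)
  fix e f assume ef: "e \<in> F" "f \<in> F" "e \<noteq> f" "ends G e \<inter> ends G f \<noteq> {}"
  then obtain v where v: "v \<in> ends G e" "v \<in> ends G f" by blast
  show "swap_colours K a b e \<noteq> swap_colours K a b f"
    using proper[OF ef] swap_colours_at[OF K ef(1) v(1)] swap_colours_at[OF K ef(2) v(2)]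
    by (simp split: if_splits)
qed

lemma extend_colouring:
  assumes "e \<in> edges G" "e \<notin> F" "ends G e = {x, y}" "a < k"
    "partner G F c a x = x" "partner G F c a y = y"
  shows "edge_colouring G (insert e F) (c(e := a)) k"
proof -
  have new: "c f \<noteq> a" if "f \<in> F" "ends G f \<inter> ends G e \<noteq> {}" for f
    using that assms partner_neq[of f x] partner_neq[of f y] by auto
  show ?thesis
  proof
    show "insert e F \<subseteq> edges G" using assms coloured by auto
    show "(c(e := a)) f < k" if "f \<in> insert e F" for f using that colours assms by auto
    fix f g assume "f \<in> insert e F" "g \<in> insert e F" "f \<noteq> g" "ends G f \<inter> ends G g \<noteq> {}"
    then show "(c(e := a)) f \<noteq> (c(e := a)) g"
      using proper new assms(2) by (auto simp: Int_commute)
  qed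
qed

text \<open>If \<open>y\<close> were outside \<open>K\<close>, swapping on \<open>K\<close> would
  make \<open>b\<close> missing at \<open>x\<close> and keep it missing at \<open>y\<close>, so
  \<open>e\<close> could get colour \<open>b\<close>.\<close>

lemma kempe_chain:
  assumes e: "e \<in> edges G" "e \<notin> F" "ends G e = {x, y}"
    and no: "\<And>c'. \<not> edge_colouring G (insert e F) c' k"
    and ab: "a < k" "b < k" "partner G F c a x = x" "partner G F c b y = y"
    and K: "kempe_closed K a b" "x \<in> K"
  shows "y \<in> K"
proof (rule ccontr)
  assume y: "y \<notin> K"
  have ne: "a \<noteq> b" using extend_colouring[OF e ab(1,3)] ab(4) no by auto
  interpret s: edge_colouring G F "swap_colours K a b" k by (rule swap_colouring[OF K(1) ab(1,2)])
  show False
    using s.extend_colouring[OF e ab(2)] partner_swap[OF K(1) ne] K(2) y ab no by auto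
qed

text \<open>The edge \<open>e\<close> at \<open>v\<close> is still uncoloured, so fewer than
  \<open>k\<close> colours occur at \<open>v\<close>.\<close>

lemma missing_colour:
  assumes e: "e \<in> edges G" "e \<notin> F" "v \<in> ends G e" and deg: "vertex_degree G v \<le> k"
  obtains a where "a < k" "partner G F c a v = v"
proof -
  let ?I = "{f \<in> F. v \<in> ends G f}"
  have fin: "finite F" using coloured finite_edges finite_subset by blast
  have "card (c ` ?I) \<le> card ?I" using fin by (intro card_image_le) auto
  also have "\<dots> < card {f \<in> edges G. v \<in> ends G f}"
    by (rule psubset_card_mono) (use finite_edges coloured e in auto)
  also have "\<dots> \<le> k" using deg by (simp add: vertex_degree_def)
  finally have "\<not> {..<k} \<subseteq> c ` ?I"
    using card_mono[of "c ` ?I" "{..<k}"] fin by auto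
  then obtain a where "a < k" "a \<notin> c ` ?I" by auto
  moreover have "partner G F c a v = v"
  proof (rule ccontr)
    assume "partner G F c a v \<noteq> v"
    then obtain e where "e \<in> F" "c e = a" "ends G e = {v, partner G F c a v}" by (rule edge_partner)
    then show False using calculation(2) by auto
  qed
  ultimately show thesis using that by blast
qed

end

section \<open>Extending a colouring by one edge\<close>

context edge_colouring
begin

text \<open>At most \<open>s - 1\<close> edges of colour \<open>a\<close> lie inside
  \<open>W\<close>, and they cover at most \<open>2 * s - 2\<close> of its \<open>2 * s + 1\<close>
  vertices.\<close>

lemma uncovered_vertices:
  assumes W: "finite W" "card W = 2 * s + 1"
    and few: "card {f \<in> F. c f = a \<and> ends G f \<subseteq> W} < s"
  shows "card {v \<in> W. partner G F c a v = v \<or> partner G F c a v \<notin> W} \<ge> 3" (is "card ?U \<ge> 3")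
proof -
  let ?E = "{f \<in> F. c f = a \<and> ends G f \<subseteq> W}"
  have fin: "finite ?E" using finite_subset[OF coloured finite_edges] by simp
  have "W - ?U \<subseteq> (\<Union>f\<in>?E. ends G f)"
  proof
    fix v assume v: "v \<in> W - ?U"
    then have "partner G F c a v \<noteq> v" by blast
    then obtain f where "f \<in> F" "c f = a" "ends G f = {v, partner G F c a v}" by (rule edge_partner)
    then show "v \<in> (\<Union>f\<in>?E. ends G f)" using v by auto
  qed
  moreover have "finite (\<Union>f\<in>?E. ends G f)"
    using fin W(1) finite_subset by blast
  ultimately have "card (W - ?U) \<le> card (\<Union>f\<in>?E. ends G f)" by (rule card_mono[rotated])
  also have "\<dots> \<le> (\<Sum>f\<in>?E. card (ends G f))" by (rule card_UN_le[OF fin])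
  also have "\<dots> = 2 * card ?E" using coloured card_ends by (simp add: subset_eq)
  finally have "card (W - ?U) + 2 \<le> 2 * s" using few by simp
  moreover have "card (W - ?U) = card W - card ?U"
    by (rule card_Diff_subset) (use W(1) in auto)
  ultimately show ?thesis using W(2) by linarith
qed

text \<open>Averaging over the colours: \<open>e\<close> lies inside \<open>W\<close> but is
  uncoloured, so fewer than \<open>k * s\<close> edges inside \<open>W\<close> are coloured.\<close>

lemma sparse_colour:
  assumes e: "e \<in> edges G" "e \<notin> F" "ends G e \<subseteq> W"
    and dens: "card {f \<in> edges G. ends G f \<subseteq> W} \<le> k * s"
  obtains a where "a < k" "card {f \<in> F. c f = a \<and> ends G f \<subseteq> W} < s"
proof -
  let ?E = "\<lambda>a. {f \<in> F. c f = a \<and> ends G f \<subseteq> W}"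
  have fin: "finite F" by (rule finite_subset[OF coloured finite_edges])
  have "(\<Sum>a<k. card (?E a)) = card (\<Union>a<k. ?E a)"
    by (rule card_UN_disjoint[symmetric]) (use fin in auto)
  also have "\<dots> < card {f \<in> edges G. ends G f \<subseteq> W}"
    by (rule psubset_card_mono) (use finite_edges coloured e in auto)
  finally have "(\<Sum>a<k. card (?E a)) < (\<Sum>a<k. s)" using dens by simp
  then obtain a where "a < k" "card (?E a) < s"
    by (meson lessThan_iff not_less sum_mono)
  then show thesis using that by blast
qed

lemma extend_to_edge:
  assumes free: "odd_C5plus_free G"
    and e: "e \<in> edges G" "e \<notin> F"
    and deg: "\<And>v. v \<in> verts G \<Longrightarrow> vertex_degree G v \<le> k"
    and dens: "\<And>v s. odd_cycle G v s \<Longrightarrow> card {f \<in> edges G. ends G f \<subseteq> v ` {..2 * s}} \<le> k * s"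
  shows "\<exists>c'. edge_colouring G (insert e F) c' k"
proof (rule ccontr)
  assume "\<not> ?thesis"
  then have no: "\<not> edge_colouring G (insert e F) c' k" for c' by blast
  have G: "multigraph G" by unfold_locales
  obtain x y where xy: "ends G e = {x, y}" "x \<noteq> y"
    using card_ends[OF e(1)] unfolding card_2_iff by blast
  have verts: "x \<in> verts G" "y \<in> verts G" using ends_in_verts[OF e(1)] xy by auto
  let ?p = "partner G F c"
  obtain \<alpha> where \<alpha>: "\<alpha> < k" "?p \<alpha> x = x" using missing_colour[OF e, of x] deg verts xy by auto
  obtain \<beta> where \<beta>: "\<beta> < k" "?p \<beta> y = y" using missing_colour[OF e, of y] deg verts xy by auto

  define w where "w = alternate (?p \<alpha>) (?p \<beta>) x"
  have w0: "w 0 = x" and wS: "w (Suc n) = (if even n then ?p \<beta> else ?p \<alpha>) (w n)" for n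
    by (simp_all add: w_def)
  obtain N where inj: "inj_on w {..N}"
    and wclosed: "\<And>v. v \<in> w ` {..N} \<Longrightarrow> ?p \<alpha> v \<in> w ` {..N} \<and> ?p \<beta> v \<in> w ` {..N}"
    unfolding w_def
    using alternate_path[OF finite_verts verts(1) partner_verts partner_verts
        partner_partner partner_partner \<alpha>(2), of \<beta>] by metis
  have "y \<in> w ` {..N}"
    by (rule kempe_chain[OF e xy(1) no \<alpha>(1) \<beta>(1) \<alpha>(2) \<beta>(2)])
      (use wclosed w0 in \<open>auto simp: kempe_closed_def intro: image_eqI[of _ _ 0]\<close>)
  then obtain j where j: "j \<le> N" "y = w j" by auto
  have winj: "m = n" if "w m = w n" "m \<le> N" "n \<le> N" for m n
    using inj_onD[OF inj that(1)] that by simp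
  \<comment> \<open>A \<open>\<beta>\<close>-step cannot end in \<open>y\<close>, which misses
    \<open>\<beta>\<close>.\<close>
  have "even j"
  proof (rule ccontr)
    assume "odd j"
    then obtain n where n: "j = Suc n" "even n" by (cases j) auto
    then have "w n = ?p \<beta> y" using wS[of n] j by simp
    then show False using winj[of n j] \<beta>(2) j n by simp
  qed
  \<comment> \<open>The next step would use \<open>\<beta>\<close> and be stationary at
    \<open>y\<close>, so the chain ends there.\<close>
  have "j = N"
  proof (rule ccontr)
    assume "j \<noteq> N"
    then show False using winj[of "Suc j" j] wS[of j] \<beta>(2) j \<open>even j\<close> by simp
  qed
  obtain s where s: "N = 2 * s" using \<open>even j\<close> \<open>j = N\<close> by blast
  have wy: "w (2 * s) = y" using j s \<open>j = N\<close> by simp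
  have s1: "s \<ge> 1" using wy w0 xy(2) by (cases s) auto
  define W where "W = w ` {..2 * s}"
  have wW: "w n \<in> W" if "n \<le> 2 * s" for n unfolding W_def using that by simp
  have Wclosed: "?p \<alpha> v \<in> W" "?p \<beta> v \<in> W" if "v \<in> W" for v
    using wclosed that unfolding W_def s by blast+
  have wneq: "w (Suc n) \<noteq> w n" if "n < 2 * s" for n using winj[of "Suc n" n] that s by auto
  \<comment> \<open>The Kempe chain from \<open>x\<close> to \<open>y\<close> together with \<open>e\<close>.\<close>
  have cyc: "odd_cycle G w s"
    unfolding odd_cycle_def
  proof (intro conjI allI impI)
    show "1 \<le> s" "inj_on w {..2 * s}" using s1 inj s by simp_all
    show "adjacent G (w (2 * s)) (w 0)"
      unfolding wy w0 adjacent_def using e xy by auto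
    show "adjacent G (w n) (w (Suc n))" if "n < 2 * s" for n
      using wneq[OF that] partner_adjacent[of _ "w n"] wS[of n] by (cases "even n") auto
  qed
  have miss_\<alpha>: "v = x" if v: "v \<in> W" "?p \<alpha> v = v" for v
  proof -
    obtain n where n: "n \<le> 2 * s" "v = w n" using v(1) unfolding W_def by auto
    show ?thesis
    proof (cases "odd n")
      case True
      then have "n < 2 * s" using n(1) by (cases "n = 2 * s") auto
      then show ?thesis using wneq[of n] wS[of n] n v True by simp
    next
      case False
      show ?thesis
      proof (cases n)
        case 0
        then show ?thesis using n w0 by simp
      next
        case (Suc m)
        then have "w n = ?p \<alpha> (w m)" using False wS[of m] by simp
        then have "?p \<alpha> v = w m" using n by simp
        then show ?thesis using wneq[of m] n v Suc by simp
      qed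
    qed
  qed
  have miss_\<beta>: "v = y" if v: "v \<in> W" "?p \<beta> v = v" for v
  proof -
    obtain n where n: "n \<le> 2 * s" "v = w n" using v(1) unfolding W_def by auto
    show ?thesis
    proof (cases "even n")
      case True
      then show ?thesis using wneq[of n] wS[of n] n v wy by (cases "n = 2 * s") auto
    next
      case False
      then obtain m where Suc: "n = Suc m" by (cases n) auto
      then have "w n = ?p \<beta> (w m)" using False wS[of m] by simp
      then have "?p \<beta> v = w m" using n by simp
      then show ?thesis using wneq[of m] n v Suc by simp
    qed
  qed

  have finW: "finite W" and cardW: "card W = 2 * s + 1"
    unfolding W_def using card_image[of w "{..2 * s}"] inj s by auto
  have "ends G e \<subseteq> W" using xy wW[of 0] wW[of "2 * s"] w0 wy by simp
  then obtain \<gamma> where \<gamma>: "\<gamma> < k" "card {f \<in> F. c f = \<gamma> \<and> ends G f \<subseteq> W} < s"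
    using sparse_colour[OF e] dens[OF cyc] unfolding W_def by blast
  define U where "U = {v \<in> W. ?p \<gamma> v = v \<or> ?p \<gamma> v \<notin> W}"
  have cardU: "card U \<ge> 3"
    unfolding U_def by (rule uncovered_vertices[OF finW cardW \<gamma>(2)])
  have UW: "U \<subseteq> W" and finU: "finite U" unfolding U_def using finW by auto
  have single: False if "U \<subseteq> {z}" for z
    using card_mono[OF _ that] cardU by simp
  \<comment> \<open>\<open>W\<close> is closed under \<open>\<alpha>\<close> and
    \<open>\<beta>\<close>, and within it only \<open>x\<close> misses \<open>\<alpha>\<close> and
    only \<open>y\<close> misses \<open>\<beta>\<close>; for either colour \<open>U\<close> would
    have at most one element.\<close>
  have "\<gamma> \<noteq> \<alpha>" using single[of x] miss_\<alpha> Wclosed(1) unfolding U_def by blast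
  have "\<gamma> \<noteq> \<beta>" using single[of y] miss_\<beta> Wclosed(2) unfolding U_def by blast
  have "\<alpha> \<noteq> \<beta>" using wneq[of 0] wS[of 0] w0 \<alpha>(2) s1 by auto

  define u where "u = alternate (?p \<alpha>) (?p \<gamma>) x"
  have u0: "u 0 = x" and uS: "u (Suc n) = (if even n then ?p \<gamma> else ?p \<alpha>) (u n)" for n
    by (simp_all add: u_def)
  obtain N' where inju: "inj_on u {..N'}"
    and uclosed: "\<And>v. v \<in> u ` {..N'} \<Longrightarrow> ?p \<alpha> v \<in> u ` {..N'} \<and> ?p \<gamma> v \<in> u ` {..N'}"
    unfolding u_def
    using alternate_path[OF finite_verts verts(1) partner_verts partner_verts
        partner_partner partner_partner \<alpha>(2), of \<gamma>] by metis
  \<comment> \<open>The \<open>\<alpha>\<close>-\<open>\<gamma>\<close> chain of \<open>x\<close> leaves the cycle for good at its first vertex in \<open>U\<close>.\<close>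
  have two: False if ij: "i < j" "j \<le> N'" "u i \<in> U" "u j \<in> U" for i j
  proof -
    define l where "l = (LEAST n. u n \<in> U)"
    have l: "u l \<in> U" unfolding l_def by (rule LeastI[of _ i]) (rule ij)
    have "l \<le> i" unfolding l_def by (rule Least_le) (rule ij)
    then have lj: "l < j" using ij by simp
    have before: "u n \<notin> U" if "n < l" for n
      using that not_less_Least[of n "\<lambda>n. u n \<in> U"] unfolding l_def by blast
    have inW: "u n \<in> W" if "n \<le> l" for n
      using that
    proof (induction n)
      case 0
      then show ?case using u0 w0 wW[of 0] by simp
    next
      case (Suc n)
      then have "u n \<in> W" "u n \<notin> U" using before[of n] by auto
      then show ?case using uS[of n] Wclosed(1)[of "u n"] unfolding U_def by (cases "even n") auto
    qed
    have uneq: "u (Suc n) \<noteq> u n" if "n < j" for n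
      using inj_onD[OF inju, of "Suc n" n] that ij by auto
    \<comment> \<open>Arriving by \<open>\<gamma>\<close> would put the
      \<open>\<gamma>\<close>-partner of \<open>u l\<close> into \<open>W\<close>, contrary to
      \<open>u l \<in> U\<close>.\<close>
    have "even l"
    proof (rule ccontr)
      assume "odd l"
      then obtain n where n: "l = Suc n" "even n" by (cases l) auto
      then have "u l = ?p \<gamma> (u n)" using uS[of n] by simp
      then have "?p \<gamma> (u l) = u n" by simp
      then show False using l inW[of n] uneq[of n] lj n unfolding U_def by auto
    qed
    then have "u (Suc l) = ?p \<gamma> (u l)" using uS[of l] by simp
    then have exit: "u (Suc l) \<notin> W" using l uneq[OF lj] unfolding U_def by auto
    have "u j \<notin> W"
      unfolding u_def W_def
      by (rule alternate_no_return[OF G free cyc partner_partner _ partner_partner _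
            inju[unfolded u_def] lj ij(2)], fold u_def W_def)
        (use exit inW[of l] Wclosed(1) \<open>even l\<close> in \<open>simp_all add: partner_adjacent\<close>)
    then show False using ij(4) UW by blast
  qed
  have "\<not> U \<subseteq> u ` {..N'}"
  proof
    assume sub: "U \<subseteq> u ` {..N'}"
    have "a = b" if ab: "a \<in> U" "b \<in> U" for a b
    proof -
      obtain i j where "i \<le> N'" "a = u i" "j \<le> N'" "b = u j" using ab sub by blast
      then show ?thesis using two[of i j] two[of j i] ab by (cases i j rule: linorder_cases) auto
    qed
    then have "card U \<le> Suc 0" using card_le_Suc0_iff_eq[OF finU] by blast
    then show False using cardU by simp
  qed
  then obtain b where b: "b \<in> U" "b \<notin> u ` {..N'}" by blast

  \<comment> \<open>The \<open>\<alpha>\<close>-\<open>\<gamma>\<close> component of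
    \<open>b\<close>, as the least closed set containing it.\<close>
  define K where "K = \<Inter>{K. kempe_closed K \<alpha> \<gamma> \<and> b \<in> K}"
  have K: "kempe_closed K \<alpha> \<gamma>" and bK: "b \<in> K" unfolding K_def kempe_closed_def by auto
  \<comment> \<open>Partners are involutions, so the complement of a closed set is closed and takes
    part in the intersection defining \<open>K\<close>.\<close>
  have Kcompl: "K \<inter> D = {}" if "kempe_closed D \<alpha> \<gamma>" "b \<notin> D" for D
  proof -
    have "kempe_closed (- D) \<alpha> \<gamma>"
      unfolding kempe_closed_def
    proof (intro ballI conjI ComplI notI)
      fix v assume v: "v \<in> - D"
      show False if "?p \<alpha> v \<in> D"
      proof -
        have "?p \<alpha> (?p \<alpha> v) \<in> D" using that(1) \<open>kempe_closed D \<alpha> \<gamma>\<close> unfolding kempe_closed_def by blast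
        then show False using v by simp
      qed
      show False if "?p \<gamma> v \<in> D"
      proof -
        have "?p \<gamma> (?p \<gamma> v) \<in> D" using that(1) \<open>kempe_closed D \<alpha> \<gamma>\<close> unfolding kempe_closed_def by blast
        then show False using v by simp
      qed
    qed
    then show ?thesis using that(2) unfolding K_def by blast
  qed
  have "kempe_closed (u ` {..N'}) \<alpha> \<gamma>" using uclosed unfolding kempe_closed_def by blast
  then have "K \<inter> u ` {..N'} = {}" using Kcompl b(2) by blast
  moreover have "x \<in> u ` {..N'}" using u0 by (auto intro: image_eqI[of _ _ 0])
  ultimately have xK: "x \<notin> K" by blast

  define i where "i = (LEAST n. w n \<in> K)"
  obtain n where n: "n \<le> 2 * s" "b = w n" using b(1) UW unfolding W_def by auto
  have iK: "w i \<in> K" unfolding i_def by (rule LeastI[of _ n]) (use bK n in simp)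
  have "i \<le> n" unfolding i_def by (rule Least_le) (use bK n in simp)
  then have i2s: "i \<le> 2 * s" using n by simp
  have before: "w n \<notin> K" if "n < i" for n
    using that not_less_Least[of n "\<lambda>n. w n \<in> K"] unfolding i_def by blast
  have Kp: "?p \<alpha> v \<in> K" "?p \<gamma> v \<in> K" if "v \<in> K" for v
    using K that unfolding kempe_closed_def by auto
  have "i \<noteq> 0" using iK w0 xK by (cases "i = 0") auto
  \<comment> \<open>If \<open>w i\<close> were reached by \<open>\<alpha>\<close>, its predecessor
    would already lie in \<open>K\<close>.\<close>
  have "odd i"
  proof (rule ccontr)
    assume "\<not> odd i"
    then obtain n where n: "i = Suc n" "odd n" using \<open>i \<noteq> 0\<close> by (cases i) auto
    then have "w i = ?p \<alpha> (w n)" using wS[of n] by simp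
    then have "?p \<alpha> (w i) = w n" by simp
    then show False using Kp(1)[OF iK] before[of n] n by simp
  qed
  then have i2s: "i < 2 * s" using i2s by (cases "i = 2 * s") auto
  \<comment> \<open>Otherwise the \<open>\<gamma>\<close>-partner of \<open>w i\<close> is on the
    cycle and in \<open>K\<close>, hence not before \<open>w i\<close>; without chords it is
    \<open>w (Suc i)\<close>. Parallel \<open>\<alpha>\<close>- and \<open>\<gamma>\<close>-edges
    then make these two vertices a closed set avoiding \<open>b\<close>, although it meets
    \<open>K\<close>.\<close>
  have iU: "w i \<in> U"
  proof (rule ccontr)
    assume iU: "w i \<notin> U"
    then have q: "?p \<gamma> (w i) \<in> W" "?p \<gamma> (w i) \<noteq> w i"
      using wW[of i] i2s unfolding U_def by auto
    obtain t where t: "t \<le> 2 * s" "?p \<gamma> (w i) = w t" using q(1) unfolding W_def by auto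
    have adj: "adjacent G (w i) (w t)" using partner_adjacent[OF q(2)] t by simp
    have "t \<ge> i" using before[of t] Kp(2)[OF iK] t(2) by (cases "t < i") auto
    then have "i < t" using q(2) t(2) by (cases "t = i") auto
    then have "t = Suc i" using odd_cycle_no_chord[OF G free cyc _ t(1) adj] \<open>i \<noteq> 0\<close> by blast
    then have \<gamma>i: "?p \<gamma> (w i) = w (Suc i)" using t by simp
    have \<alpha>i: "?p \<alpha> (w i) = w (Suc i)" using wS[of i] \<open>odd i\<close> by simp
    have \<gamma>i': "?p \<gamma> (w (Suc i)) = w i" unfolding \<gamma>i[symmetric] by simp
    have \<alpha>i': "?p \<alpha> (w (Suc i)) = w i" unfolding \<alpha>i[symmetric] by simp
    have "w (Suc i) \<notin> U" using \<gamma>i' wneq[OF i2s] wW[of i] i2s unfolding U_def by auto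
    then have "b \<notin> {w i, w (Suc i)}" using iU b(1) by auto
    moreover have "kempe_closed {w i, w (Suc i)} \<alpha> \<gamma>"
      using \<gamma>i \<gamma>i' \<alpha>i \<alpha>i' by (simp add: kempe_closed_def)
    ultimately show False using Kcompl[of "{w i, w (Suc i)}"] iK by blast
  qed

  \<comment> \<open>After swapping on \<open>K\<close>, the \<open>\<alpha>\<close>-\<open>\<beta>\<close> chain of \<open>x\<close> follows the cycle up to \<open>w i\<close> and leaves it there, so
    it cannot reach \<open>y\<close>.\<close>
  let ?c = "swap_colours K \<alpha> \<gamma>"
  let ?q = "partner G F ?c"
  interpret s: edge_colouring G F ?c k by (rule swap_colouring[OF K \<alpha>(1) \<gamma>(1)])
  have q\<alpha>: "?q \<alpha> v = (if v \<in> K then ?p \<gamma> v else ?p \<alpha> v)" for v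
    using partner_swap(1)[OF K] \<open>\<gamma> \<noteq> \<alpha>\<close> by simp
  have q\<beta>: "?q \<beta> v = ?p \<beta> v" for v
    using partner_swap(3)[OF K] \<open>\<gamma> \<noteq> \<alpha>\<close> \<open>\<alpha> \<noteq> \<beta>\<close> \<open>\<gamma> \<noteq> \<beta>\<close> by metis
  have qx: "?q \<alpha> x = x" using q\<alpha> \<alpha>(2) xK by simp
  have qy: "?q \<beta> y = y" using q\<beta> \<beta>(2) by simp
  define z where "z = alternate (?q \<alpha>) (?q \<beta>) x"
  have z0: "z 0 = x" and zS: "z (Suc n) = (if even n then ?q \<beta> else ?q \<alpha>) (z n)" for n
    by (simp_all add: z_def)
  obtain M where injz: "inj_on z {..M}"
    and zclosed: "\<And>v. v \<in> z ` {..M} \<Longrightarrow> ?q \<alpha> v \<in> z ` {..M} \<and> ?q \<beta> v \<in> z ` {..M}"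
    unfolding z_def
    using alternate_path[OF finite_verts verts(1) s.partner_verts s.partner_verts
        s.partner_partner s.partner_partner qx, of \<beta>] by metis
  have "y \<in> z ` {..M}"
    by (rule s.kempe_chain[OF e xy(1) no \<alpha>(1) \<beta>(1) qx qy])
      (use zclosed z0 in \<open>auto simp: s.kempe_closed_def intro: image_eqI[of _ _ 0]\<close>)
  then obtain m where m: "m \<le> M" "y = z m" by auto
  \<comment> \<open>Before index \<open>i\<close> the walk is outside \<open>K\<close>, where
    \<open>\<alpha>\<close>-partners are unchanged; \<open>\<beta>\<close>-partners never
    change.\<close>
  have zw: "z n = w n" if "n \<le> i" for n
    using that
  proof (induction n)
    case 0
    then show ?case using z0 w0 by simp
  next
    case (Suc n)
    then show ?case using zS[of n] wS[of n] q\<alpha>[of "w n"] q\<beta> before[of n] by (cases "even n") auto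
  qed
  have "i < m"
  proof (rule ccontr)
    assume "\<not> i < m"
    then have "w m = w (2 * s)" "m < 2 * s" using zw[of m] m wy i2s by auto
    then show False using winj[of m "2 * s"] s by simp
  qed
  \<comment> \<open>As \<open>i\<close> is odd the next step uses the new \<open>\<alpha>\<close>,
    which inside \<open>K\<close> is the old \<open>\<gamma>\<close>.\<close>
  have "z (Suc i) = ?p \<gamma> (w i)" using zS[of i] zw[of i] q\<alpha> iK \<open>odd i\<close> by simp
  moreover have "z (Suc i) \<noteq> z i" using inj_onD[OF injz, of "Suc i" i] \<open>i < m\<close> m(1) by auto
  ultimately have exit: "z (Suc i) \<notin> W" using iU zw[of i] unfolding U_def by auto
  have "z m \<notin> W"
    unfolding z_def W_def
    by (rule alternate_no_return[OF G free cyc s.partner_partner _ s.partner_partner _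
          injz[unfolded z_def] \<open>i < m\<close> m(1)], fold z_def W_def)
      (use exit zw[of i] wW[of i] i2s Wclosed(2) \<open>odd i\<close> in
        \<open>simp_all add: q\<beta> partner_adjacent s.partner_adjacent\<close>)
  then show False using m(2) wy wW[of "2 * s"] by simp
qed

end

section \<open>The chromatic index\<close>

lemma colouring_exists:
  assumes G: "multigraph G" and free: "odd_C5plus_free G"
    and deg: "\<And>v. v \<in> verts G \<Longrightarrow> vertex_degree G v \<le> k"
    and dens: "\<And>v s. odd_cycle G v s \<Longrightarrow> card {f \<in> edges G. ends G f \<subseteq> v ` {..2 * s}} \<le> k * s"
  shows "\<exists>c. edge_colouring G (edges G) c k"
proof -
  have "\<exists>c. edge_colouring G F c k" if "finite F" "F \<subseteq> edges G" for F
    using that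
  proof (induction F rule: finite_induct)
    case empty
    have "edge_colouring G {} (\<lambda>_. 0) k"
      using G by (simp add: edge_colouring_def edge_colouring_axioms_def)
    then show ?case by blast
  next
    case (insert e F)
    then obtain c where "edge_colouring G F c k" by auto
    then interpret edge_colouring G F c k .
    show ?case using insert by (intro extend_to_edge[OF free _ _ deg dens]) auto
  qed
  then show ?thesis using multigraph.finite_edges[OF G] by blast
qed

section \<open>Lower bounds from covers by matchings\<close>

definition edge_coverable :: "('a, 'b) pre_multigraph \<Rightarrow> nat \<Rightarrow> bool" where
  "edge_coverable G k \<longleftrightarrow>
     (\<exists>M :: nat \<Rightarrow> 'b set. (\<forall>i<k. matching G (M i)) \<and> edges G = (\<Union>i<k. M i))"

lemma edge_coverable_if_colouring:
  assumes "edge_colouring G (edges G) c k"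
  shows "edge_coverable G k"
proof -
  interpret edge_colouring G "edges G" c k by (rule assms)
  have "matching G {e \<in> edges G. c e = i}" for i
    unfolding matching_def using proper by blast
  moreover have "edges G = (\<Union>i<k. {e \<in> edges G. c e = i})" using colours by auto
  ultimately show ?thesis
    unfolding edge_coverable_def by (intro exI[of _ "\<lambda>i. {e \<in> edges G. c e = i}"]) blast
qed

lemma card_matching_le:
  assumes G: "multigraph G" and M: "matching G M" "\<And>e. e \<in> M \<Longrightarrow> ends G e \<subseteq> X" and X: "finite X"
  shows "2 * card M \<le> card X"
proof -
  interpret multigraph G by (rule G)
  have ME: "M \<subseteq> edges G" using M(1) unfolding matching_def by blast
  have fin: "finite M" by (rule finite_subset[OF ME finite_edges])
  have "(\<Sum>e\<in>M. card (ends G e)) = card (\<Union>e\<in>M. ends G e)"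
    by (rule card_UN_disjoint[symmetric])
      (use fin finite_subset[OF M(2) X] M(1) in \<open>auto simp: matching_def\<close>)
  also have "\<dots> \<le> card X" by (rule card_mono[OF X]) (use M(2) in blast)
  finally show ?thesis using ME card_ends by (simp add: subset_eq)
qed

text \<open>Common source of both lower bounds: \<open>s = 1\<close> for the edges at a vertex, and
  \<open>s\<close> half of one less than the order for an odd ring.\<close>

lemma edge_coverable_card_le:
  assumes G: "multigraph G" and cov: "edge_coverable G k" and E: "E \<subseteq> edges G"
    and bound: "\<And>M. matching G M \<Longrightarrow> M \<subseteq> E \<Longrightarrow> card M \<le> s"
  shows "card E \<le> k * s"
proof -
  obtain M where M: "\<And>i. i < k \<Longrightarrow> matching G (M i)" "edges G = (\<Union>i<k. M i)"
    using cov unfolding edge_coverable_def by blast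
  have "E = (\<Union>i<k. M i \<inter> E)" using M(2) E by blast
  then have "card E \<le> (\<Sum>i<k. card (M i \<inter> E))"
    using card_UN_le[of "{..<k}" "\<lambda>i. M i \<inter> E"] by simp
  also have "\<dots> \<le> (\<Sum>i<k. s)"
    by (rule sum_mono, rule bound) (use M(1) in \<open>auto simp: matching_def\<close>)
  finally show ?thesis by simp
qed

lemma edge_coverable_degree:
  assumes G: "multigraph G" and cov: "edge_coverable G k"
  shows "vertex_degree G v \<le> k"
proof -
  have "card M \<le> 1" if M: "matching G M" "M \<subseteq> {e \<in> edges G. v \<in> ends G e}" for M
  proof -
    have "finite M" using finite_subset[OF M(2)] multigraph.finite_edges[OF G] by simp
    moreover have "e = f" if ef: "e \<in> M" "f \<in> M" for e f
    proof -
      have "v \<in> ends G e \<inter> ends G f" using ef M(2) by auto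
      then show ?thesis using ef M(1) unfolding matching_def by (metis empty_iff)
    qed
    ultimately show ?thesis by (simp add: card_le_Suc0_iff_eq)
  qed
  then have "card {e \<in> edges G. v \<in> ends G e} \<le> k * 1"
    by (intro edge_coverable_card_le[OF G cov]) auto
  then show ?thesis by (simp add: vertex_degree_def)
qed

section \<open>Odd rings and the density bound\<close>

lemma odd_ring_card_verts:
  assumes "odd_ring G R"
  obtains X s where "X \<subseteq> verts G" "R = induced_subgraph G X" "card X = 2 * s + 1" "s \<ge> 1"
proof -
  obtain X where X: "X \<subseteq> verts G" "R = induced_subgraph G X" "odd_circuit (underlying_simple R)"
    using assms unfolding odd_ring_def by blast
  then obtain vs where vs: "distinct vs" "length vs \<ge> 3" "odd (length vs)" "X = set vs"
    unfolding odd_circuit_def underlying_simple_def induced_subgraph_def by auto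
  then obtain s where s: "length vs = 2 * s + 1" by (auto elim: oddE)
  show thesis
    by (rule that[of X s]) (use X vs s distinct_card[of vs] in auto)
qed

lemma odd_ring_le_chromatic:
  assumes G: "multigraph G" and cov: "edge_coverable G k" and R: "odd_ring G R"
  shows "2 / (real (card (verts R)) - 1) * real (card (edges R)) \<le> real k"
proof -
  obtain X s where X: "X \<subseteq> verts G" "R = induced_subgraph G X" "card X = 2 * s + 1" "s \<ge> 1"
    using R by (rule odd_ring_card_verts)
  have "card M \<le> s" if M: "matching G M" "M \<subseteq> edges R" for M
  proof -
    have "2 * card M \<le> card X"
      by (rule card_matching_le[OF G M(1)])
        (use M(2) X(2) finite_subset[OF X(1) multigraph.finite_verts[OF G]] in
          \<open>auto simp: induced_subgraph_def\<close>)
    then show ?thesis using X(3) by simp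
  qed
  then have "card (edges R) \<le> k * s"
    using X(2) by (intro edge_coverable_card_le[OF G cov]) (auto simp: induced_subgraph_def)
  then have "real (card (edges R)) \<le> real k * real s"
    by (metis of_nat_le_iff of_nat_mult)
  moreover have "card (verts R) = 2 * s + 1" using X(2,3) by (simp add: induced_subgraph_def)
  ultimately show ?thesis using X(4) by (simp add: field_simps)
qed

text \<open>An odd ring is determined by its vertex set. Finiteness makes the \<open>Max\<close> in
  \<open>Gamma_prime\<close> a genuine maximum.\<close>

lemma finite_odd_rings:
  assumes "multigraph G"
  shows "finite {f R |R. odd_ring G R}"
proof (rule finite_subset)
  show "{f R |R. odd_ring G R} \<subseteq> (\<lambda>X. f (induced_subgraph G X)) ` Pow (verts G)"
    unfolding odd_ring_def by auto
  show "finite ((\<lambda>X. f (induced_subgraph G X)) ` Pow (verts G))"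
    using multigraph.finite_verts[OF assms] by simp
qed

lemma Gamma_prime_le:
  assumes G: "multigraph G" and cov: "edge_coverable G k"
  shows "Gamma_prime G \<le> real k"
proof (cases "\<exists>R. odd_ring G R")
  case True
  then show ?thesis
    unfolding Gamma_prime_def
    using odd_ring_le_chromatic[OF G cov] finite_odd_rings[OF G]
    by (auto intro!: Max.boundedI)
next
  case False
  then show ?thesis by (simp add: Gamma_prime_def)
qed

lemma Gamma_prime_ge:
  assumes "multigraph G" "odd_ring G R"
  shows "2 / (real (card (verts R)) - 1) * real (card (edges R)) \<le> Gamma_prime G"
  unfolding Gamma_prime_def using assms(2) by (auto intro!: Max_ge finite_odd_rings[OF assms(1)])

text \<open>Since odd cycles have no chords, the vertices of one induce only edges parallel to its
  own. Hence \<open>Gamma_prime\<close> bounds the number of edges spanned by any odd cycle.\<close>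

lemma odd_ring_odd_cycle:
  assumes G: "multigraph G" and free: "odd_C5plus_free G" and C: "odd_cycle G v s"
  shows "odd_ring G (induced_subgraph G (v ` {..2 * s}))"
proof -
  interpret multigraph G by (rule G)
  let ?W = "v ` {..2 * s}"
  let ?vs = "map v [0..<Suc (2 * s)]"
  have s: "s \<ge> 1" and inj: "inj_on v {..2 * s}"
    and adj: "\<And>i. i < 2 * s \<Longrightarrow> adjacent G (v i) (v (Suc i))" "adjacent G (v (2 * s)) (v 0)"
    using C unfolding odd_cycle_def by auto
  have next_v: "?vs ! (Suc i mod length ?vs) = (if i = 2 * s then v 0 else v (Suc i))"
    if "i \<le> 2 * s" for i
    using that by (simp del: upt_Suc)
  have adj_next: "adjacent G (?vs ! i) (?vs ! (Suc i mod length ?vs))" if "i < length ?vs" for i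
    using that adj next_v[of i] by (simp del: upt_Suc)
  have "?W \<subseteq> verts G"
  proof
    fix u assume "u \<in> ?W"
    then obtain i where "i \<le> 2 * s" "u = v i" by auto
    then have "\<exists>u'. adjacent G u u'" using adj(1)[of i] adj(2) by (cases "i = 2 * s") auto
    then obtain u' where "adjacent G u u'" by blast
    then show "u \<in> verts G" using ends_in_verts unfolding adjacent_def by fastforce
  qed
  moreover have "odd_circuit (underlying_simple (induced_subgraph G ?W))"
    unfolding odd_circuit_def
  proof (intro exI conjI)
    show "distinct ?vs" using inj by (simp add: distinct_map atLeast0AtMost atLeastLessThanSuc_atLeastAtMost del: upt_Suc)
    show "3 \<le> length ?vs" "odd (length ?vs)" using s by simp_all
    show "verts (underlying_simple (induced_subgraph G ?W)) = set ?vs"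
      by (simp add: underlying_simple_def induced_subgraph_def atLeast0AtMost
          atLeastLessThanSuc_atLeastAtMost del: upt_Suc)
    show "\<forall>e\<in>edges (underlying_simple (induced_subgraph G ?W)).
        ends (underlying_simple (induced_subgraph G ?W)) e = e"
      by (simp add: underlying_simple_def)
    show "edges (underlying_simple (induced_subgraph G ?W)) =
        {{?vs ! i, ?vs ! (Suc i mod length ?vs)} |i. i < length ?vs}" (is "?L = ?R")
    proof
      have edge: "{v i, v j} \<in> ?R" if ij: "i < j" "j \<le> 2 * s" "adjacent G (v i) (v j)" for i j
      proof -
        consider "j = Suc i" | "i = 0" "j = 2 * s"
          using odd_cycle_no_chord[OF G free C ij] by blast
        then show ?thesis
        proof cases
          case 1
          then have "{v i, v j} = {?vs ! i, ?vs ! (Suc i mod length ?vs)}" "i < length ?vs"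
            using next_v[of i] ij(2) by (simp_all del: upt_Suc)
          then show ?thesis by blast
        next
          \<comment> \<open>The closing edge is listed at index \<open>2 * s\<close>, whose
            successor wraps around to \<open>0\<close>.\<close>
          case 2
          then have "{v i, v j} = {?vs ! j, ?vs ! (Suc j mod length ?vs)}" "j < length ?vs"
            using next_v[of j] by (simp_all add: insert_commute del: upt_Suc)
          then show ?thesis by blast
        qed
      qed
      show "?L \<subseteq> ?R"
      proof
        fix X assume "X \<in> ?L"
        then obtain e where e: "e \<in> edges G" "ends G e \<subseteq> ?W" "X = ends G e"
          by (auto simp: underlying_simple_def induced_subgraph_def)
        obtain a b where ab: "ends G e = {a, b}" "a \<noteq> b"
          using card_ends[OF e(1)] unfolding card_2_iff by blast
        then obtain i j where ij: "i \<le> 2 * s" "a = v i" "j \<le> 2 * s" "b = v j" using e(2) by auto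
        have "adjacent G (v i) (v j)" using ab ij e(1) unfolding adjacent_def by auto
        moreover have "i \<noteq> j" using ab ij by auto
        ultimately have "{v i, v j} \<in> ?R"
          using edge[of i j] edge[of j i] ij adjacent_commute[of G "v i" "v j"]
          by (cases "i < j") (auto simp: insert_commute simp del: upt_Suc)
        then show "X \<in> ?R" using e(3) ab(1) ij by simp
      qed
      show "?R \<subseteq> ?L"
      proof
        fix X assume "X \<in> ?R"
        then obtain i where i: "i < length ?vs" "X = {?vs ! i, ?vs ! (Suc i mod length ?vs)}" by blast
        obtain e where e: "e \<in> edges G" "ends G e = X"
          using adj_next[OF i(1)] i(2) unfolding adjacent_def by auto
        have "set ?vs = ?W" by (simp add: atLeast0AtMost atLeastLessThanSuc_atLeastAtMost del: upt_Suc)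
        moreover have "Suc i mod length ?vs < length ?vs" by (rule mod_less_divisor) simp
        ultimately have "X \<subseteq> ?W" using i nth_mem by blast
        then show "X \<in> ?L" using e by (auto simp: underlying_simple_def induced_subgraph_def)
      qed
    qed
  qed
  ultimately show ?thesis unfolding odd_ring_def by blast
qed

theorem corollary2:
  fixes H :: "('a, 'b) pre_multigraph"
  assumes "multigraph H"
    and "odd_C5plus_free H"
  shows "int (chromatic_index H) = max (int (max_degree H)) \<lceil>Gamma_prime H\<rceil>"
proof (rule antisym)
  interpret multigraph H by fact
  \<comment> \<open>The maximum is at least \<open>max_degree H\<close>, hence nonnegative, and
    \<open>nat\<close> keeps its value.\<close>
  define k where "k = nat (max (int (max_degree H)) \<lceil>Gamma_prime H\<rceil>)"
  have k: "int k = max (int (max_degree H)) \<lceil>Gamma_prime H\<rceil>" 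
    unfolding k_def by (simp only: nat_0_le max.coboundedI1 of_nat_0_le_iff)
  have "vertex_degree H v \<le> k" if "v \<in> verts H" for v
  proof -
    have "vertex_degree H v \<le> max_degree H"
      unfolding max_degree_def using finite_verts that by (intro Max_ge) auto
    then show ?thesis using k by simp
  qed
  moreover have "card {f \<in> edges H. ends H f \<subseteq> v ` {..2 * s}} \<le> k * s" if C: "odd_cycle H v s" for v s
  proof -
    let ?R = "induced_subgraph H (v ` {..2 * s})"
    have s: "s \<ge> 1" "card (v ` {..2 * s}) = 2 * s + 1"
      using C card_image[of v "{..2 * s}"] unfolding odd_cycle_def by auto
    have "2 / (real (card (verts ?R)) - 1) * real (card (edges ?R)) \<le> Gamma_prime H"
      by (rule Gamma_prime_ge[OF assms(1) odd_ring_odd_cycle[OF assms C]])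
    also have "\<dots> \<le> real k" using k by linarith
    finally have "real (card (edges ?R)) \<le> real k * real s"
      using s by (simp add: induced_subgraph_def field_simps)
    then have "real (card (edges ?R)) \<le> real (k * s)" by simp
    then have "card (edges ?R) \<le> k * s" by (simp only: of_nat_le_iff)
    then show ?thesis by (simp add: induced_subgraph_def)
  qed
  ultimately have cov: "edge_coverable H k"
    using colouring_exists[OF assms] edge_coverable_if_colouring by blast
  have index: "chromatic_index H = (LEAST k. edge_coverable H k)"
    unfolding chromatic_index_def edge_coverable_def ..
  show "int (chromatic_index H) \<le> max (int (max_degree H)) \<lceil>Gamma_prime H\<rceil>"
    unfolding k[symmetric] index using cov by (simp add: Least_le)
  have cov': "edge_coverable H (chromatic_index H)" unfolding index using cov by (rule LeastI)
  have "max_degree H \<le> chromatic_index H"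
    unfolding max_degree_def using finite_verts edge_coverable_degree[OF assms(1) cov']
    by (intro Max.boundedI) auto
  moreover have "\<lceil>Gamma_prime H\<rceil> \<le> int (chromatic_index H)"
    using Gamma_prime_le[OF assms(1) cov'] by (simp add: ceiling_le_iff)
  ultimately show "max (int (max_degree H)) \<lceil>Gamma_prime H\<rceil> \<le> int (chromatic_index H)"
    by simp
qed

end
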